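(* Let $k\ge0$ be an integer and let $\mathbf{t}$ be a fixed finite plane tree whose height is at least $k$. For every $\varepsilon>0$ there exist $\delta>0$ and $n_0\ge0$ such that for all $n\ge n_0$ (with $\mathbb{P}(|\mathcal{T}|=n)>0$), $$\mathbb{P}\left(\left|\frac1n\sum_{x\in\mathcal{T}_n}\mathbf{1}_{\{H_k(\mathcal{T}_n,x)=\mathbf{t}\}}-\mathbb{P}\big(H_k(\mathcal{T}^*,u_0)=\mathbf{t}\big)\right|\ge\varepsilon\right)\le e^{-\delta n}.$$
   Context: $\nu=\sum_{k\ge0}\nu_k\delta_k$ is a probability distribution on $\{0,1,2,\dots\}$ with mean $1$ and finite variance, $\nu\neq\delta_1$. $\mathcal{T}$ is the (rooted plane) Galton–Watson tree with offspring distribution $\nu$; $\mathcal{T}_n$ is $\mathcal{T}$ conditioned to have exactly $n$ vertices (only values of $n$ with $\mathbb{P}(|\mathcal{T}|=n)>0$ are considered). For a plane tree $\mathbf{s}$ and a vertex $y$, $\operatorname{Top}(\mathbf{s},y)$ is the (plane) subtree of $\mathbf{s}$ formed by $y$ and its descendants, rooted at $y$. For a vertex $x$ of $\mathbf{s}$ and $k\ge0$, $H_k(\mathbf{s},x)=\operatorname{Top}(\mathbf{s},x_k)$, where $x_k$ is the $k$-th ancestor of $x$ (with $x_0=x$) if it exists; otherwise $H_k(\mathbf{s},x)=\lozenge$, a cemetery symbol different from all trees. Aldous' random sin-tree $\mathcal{T}^*$ is the infinite plane tree, pointed at $u_0$, defined as follows. Take a semi-infinite path $(u_j)_{j\ge0}$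 in which $u_{j+1}$ is the parent of $u_j$ for all $j\ge0$. Independently, graft on $u_0$ a random number $X\sim\nu$ of independent Galton–Watson trees with law $\mathcal{T}$, and on each $u_j$, $j\ge1$, a random number $Y-1$ of independent Galton–Watson trees with law $\mathcal{T}$, where $Y\sim\overline\nu$ with $\overline\nu(i)=i\nu_i$ for $i\ge1$; the children of each $u_j$ are put in a uniformly random order. *)

theory Defs
  imports "HOL-Probability.Probability" "HOL-Combinatorics.Multiset_Permutations"
begin

section \<open>Plane trees\<close>

text \<open>
  A locally finite plane tree, rooted or not, is given by its vertex set and the ordered list of
  children of each vertex. Values of \<^term>\<open>children\<close> outside the vertex set are irrelevant.
\<close>

record 'v plane_tree =
  verts :: "'v set"
  children :: "'v \<Rightarrow> 'v list"

definition parent :: "'v plane_tree \<Rightarrow> 'v \<Rightarrow> 'v option" where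
  "parent s x =
     (if \<exists>y\<in>verts s. x \<in> set (children s y)
      then Some (THE y. y \<in> verts s \<and> x \<in> set (children s y))
      else None)"

primrec ancestor :: "'v plane_tree \<Rightarrow> 'v \<Rightarrow> nat \<Rightarrow> 'v option" where
  "ancestor s x 0 = Some x"
| "ancestor s x (Suc k) = Option.bind (ancestor s x k) (parent s)"

definition has_size :: "'v plane_tree \<Rightarrow> nat \<Rightarrow> bool" where
  "has_size s n \<longleftrightarrow> finite (verts s) \<and> card (verts s) = n"

text \<open>
  Rooted plane trees up to isomorphism are represented by their sets of Ulam--Harris words: the
  empty word is the root, and \<^term>\<open>w @ [i]\<close> is the child number \<^term>\<open>i\<close> (counting from 0) of the
  vertex \<^term>\<open>w\<close>.
\<close>

type_synonym word_tree = "nat list set"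

definition finite_word_tree :: "word_tree \<Rightarrow> bool" where
  "finite_word_tree t \<longleftrightarrow>
     finite t \<and> [] \<in> t \<and>
     (\<forall>w i. w @ [i] \<in> t \<longrightarrow> w \<in> t) \<and>
     (\<forall>w i j. w @ [i] \<in> t \<longrightarrow> j < i \<longrightarrow> w @ [j] \<in> t)"

definition height :: "word_tree \<Rightarrow> nat" where
  "height t = Max (length ` t)"

primrec descend :: "'v plane_tree \<Rightarrow> 'v \<Rightarrow> nat list \<Rightarrow> 'v option" where
  "descend s y [] = Some y"
| "descend s y (i # w) =
     (if i < length (children s y) then descend s (children s y ! i) w else None)"

text \<open>
  The tree formed by a vertex and its descendants, as a set of words relative to that vertex; it
  may be infinite.
\<close>

definition Top :: "'v plane_tree \<Rightarrow> 'v \<Rightarrow> word_tree" where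
  "Top s y = {w. descend s y w \<noteq> None}"

text \<open>The value \<^term>\<open>None\<close> is the cemetery symbol.\<close>

definition H :: "nat \<Rightarrow> 'v plane_tree \<Rightarrow> 'v \<Rightarrow> word_tree option" where
  "H k s x = map_option (Top s) (ancestor s x k)"


section \<open>The Galton--Watson tree\<close>

text \<open>
  Every word \<^term>\<open>u\<close> carries an independent offspring number \<^term>\<open>\<omega> u\<close> of law \<open>\<nu>\<close>; the tree
  consists of the words all of whose letters are admissible.
\<close>

definition GW_space :: "nat pmf \<Rightarrow> (nat list \<Rightarrow> nat) measure" where
  "GW_space \<nu> = (\<Pi>\<^sub>M u\<in>UNIV. measure_pmf \<nu>)"

definition GW_tree :: "(nat list \<Rightarrow> nat) \<Rightarrow> nat list plane_tree" where
  "GW_tree \<omega> =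
     \<lparr> verts = {u. \<forall>i<length u. u ! i < \<omega> (take i u)},
       children = (\<lambda>u. map (\<lambda>i. u @ [i]) [0..<\<omega> u]) \<rparr>"


section \<open>The sin-tree\<close>

text \<open>This is a probability mass function when \<open>\<nu>\<close> has mean 1; see \<open>pmf_size_biased\<close> below.\<close>

definition size_biased :: "nat pmf \<Rightarrow> nat pmf" where
  "size_biased \<nu> = embed_pmf (\<lambda>i. real i * pmf \<nu> i)"

text \<open>
  The children of \<open>u\<^sub>j\<close> are labelled \<open>0, \<dots>, m - 1\<close> and put in a uniformly random order, where
  \<open>m\<close> has law \<open>\<nu>\<close> for \<open>j = 0\<close> and the size-biased law for \<open>j \<ge> 1\<close>. For \<open>j \<ge> 1\<close> the label \<open>0\<close>
  stands for the previous vertex of the spine, all other labels for roots of grafted trees.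
\<close>

definition spine_order :: "nat pmf \<Rightarrow> nat \<Rightarrow> nat list pmf" where
  "spine_order \<nu> j =
     bind_pmf (if j = 0 then \<nu> else size_biased \<nu>)
       (\<lambda>m. pmf_of_set (permutations_of_set {..<m}))"

definition sin_space ::
    "nat pmf \<Rightarrow> ((nat \<Rightarrow> nat list) \<times> (nat \<times> nat list \<Rightarrow> nat)) measure" where
  "sin_space \<nu> =
     (\<Pi>\<^sub>M j\<in>UNIV. measure_pmf (spine_order \<nu> j)) \<Otimes>\<^sub>M (\<Pi>\<^sub>M x\<in>UNIV. measure_pmf \<nu>)"

text \<open>
  The vertex \<open>u\<^sub>j\<close> is \<^term>\<open>(j, [])\<close>, and \<^term>\<open>(j, i # w)\<close> is the vertex \<^term>\<open>w\<close> of the tree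
  grafted on \<open>u\<^sub>j\<close> with label \<^term>\<open>i\<close>. The offspring numbers \<^term>\<open>\<omega> (j, [])\<close> are not used.
\<close>

definition sin_children ::
    "(nat \<Rightarrow> nat list) \<times> (nat \<times> nat list \<Rightarrow> nat) \<Rightarrow> nat \<times> nat list \<Rightarrow> (nat \<times> nat list) list" where
  "sin_children = (\<lambda>(ord, \<omega>) (j, v).
     if v = [] then map (\<lambda>i. if 0 < j \<and> i = 0 then (j - 1, []) else (j, [i])) (ord j)
     else map (\<lambda>i. (j, v @ [i])) [0..<\<omega> (j, v)])"

definition sin_tree ::
    "(nat \<Rightarrow> nat list) \<times> (nat \<times> nat list \<Rightarrow> nat) \<Rightarrow> (nat \<times> nat list) plane_tree" where
  "sin_tree \<xi> =
     \<lparr> verts = {y. \<exists>j. ((j, []), y) \<in> {(a, b). b \<in> set (sin_children \<xi> a)}\<^sup>*},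
       children = sin_children \<xi> \<rparr>"


section \<open>Basic facts\<close>

lemma pmf_size_biased:
  assumes "measure_pmf.expectation \<nu> real = 1"
  shows "pmf (size_biased \<nu>) i = real i * pmf \<nu> i"
  unfolding size_biased_def
proof (rule pmf_embed_pmf)
  have int: "integrable (measure_pmf \<nu>) real"
    using assms not_integrable_integral_eq by fastforce
  have "(\<integral>\<^sup>+ i. ennreal (real i * pmf \<nu> i) \<partial>count_space UNIV)
      = (\<integral>\<^sup>+ i. ennreal (pmf \<nu> i) * ennreal (real i) \<partial>count_space UNIV)"
    by (simp add: ennreal_mult mult.commute)
  also have "\<dots> = (\<integral>\<^sup>+ i. ennreal (real i) \<partial>measure_pmf \<nu>)"
    by (simp add: nn_integral_measure_pmf)
  also have "\<dots> = 1"
    using nn_integral_eq_integral[OF int] assms by simp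
  finally show "(\<integral>\<^sup>+ i. ennreal (real i * pmf \<nu> i) \<partial>count_space UNIV) = 1" .
qed simp

lemma Top_GW_tree:
  assumes "u \<in> verts (GW_tree \<omega>)"
  shows "Top (GW_tree \<omega>) u = {w. u @ w \<in> verts (GW_tree \<omega>)}"
proof -
  have ext: "v @ [i] \<in> verts (GW_tree \<omega>) \<longleftrightarrow> v \<in> verts (GW_tree \<omega>) \<and> i < \<omega> v" for v i
    by (auto simp: GW_tree_def nth_append less_Suc_eq)
  have pre: "v @ w \<in> verts (GW_tree \<omega>) \<Longrightarrow> v \<in> verts (GW_tree \<omega>)" for v w
    by (induction w rule: rev_induct) (auto simp: ext simp flip: append_assoc)
  have "descend (GW_tree \<omega>) u w \<noteq> None \<longleftrightarrow> u @ w \<in> verts (GW_tree \<omega>)" for w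
    using assms
  proof (induction w arbitrary: u)
    case (Cons i w)
    have len: "length (children (GW_tree \<omega>) u) = \<omega> u"
      by (simp add: GW_tree_def)
    show ?case
    proof (cases "i < \<omega> u")
      case True
      then have "children (GW_tree \<omega>) u ! i = u @ [i]"
        by (simp add: GW_tree_def)
      with True Cons.IH[of "u @ [i]"] Cons.prems len show ?thesis
        by (simp add: ext)
    next
      case False
      with pre[of "u @ [i]" w] len show ?thesis
        by (auto simp: ext)
    qed
  qed simp
  then show ?thesis by (simp add: Top_def)
qed

lemma parent_GW_tree:
  assumes "u @ [i] \<in> verts (GW_tree \<omega>)"
  shows "parent (GW_tree \<omega>) (u @ [i]) = Some u"
proof -
  have "u \<in> verts (GW_tree \<omega>) \<and> u @ [i] \<in> set (children (GW_tree \<omega>) u)"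
    using assms by (auto simp: GW_tree_def nth_append less_Suc_eq)
  moreover have "y = u" if "u @ [i] \<in> set (children (GW_tree \<omega>) y)" for y
    using that by (auto simp: GW_tree_def)
  ultimately have "(THE y. y \<in> verts (GW_tree \<omega>) \<and> u @ [i] \<in> set (children (GW_tree \<omega>) y)) = u"
    by blast
  with \<open>u \<in> verts (GW_tree \<omega>) \<and> _\<close> show ?thesis
    by (auto simp: parent_def)
qed

lemma parent_sin_tree:
  assumes "0 \<in> set (ord (Suc j))"
  shows "parent (sin_tree (ord, \<omega>)) (j, []) = Some (Suc j, [])"
proof -
  let ?s = "sin_tree (ord, \<omega>)"
  have *: "(Suc j, []) \<in> verts ?s" "(j, []) \<in> set (children ?s (Suc j, []))"
    using assms by (auto simp: sin_tree_def sin_children_def image_iff intro: bexI[of _ 0])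
  moreover have "y = (Suc j, [])" if "(j, []) \<in> set (children ?s y)" for y
    using that by (cases y) (auto simp: sin_tree_def sin_children_def split: if_splits)
  ultimately have "(THE y. y \<in> verts ?s \<and> (j, []) \<in> set (children ?s y)) = (Suc j, [])"
    by blast
  with * show ?thesis by (auto simp: parent_def)
qed

end

theory Submission
  imports Defs "HOL-Real_Asymp.Real_Asymp"
begin

text \<open>
  Let \<open>p = P(T = t)\<close>, let \<open>Z\<close> be the number of vertices of \<open>t\<close> at height \<open>k\<close>, and let \<open>F\<close> count the
  vertices \<open>y\<close> with \<open>Top(T, y) = t\<close>. The sum over \<open>x\<close> equals \<open>Z F\<close>, and along the spine every
  size-biasing factor \<open>i\<close> cancels against the uniform position \<open>1 / i\<close>, so that
  \<open>P(H\<^sub>k(T*, u\<^sub>0) = t) = Z p\<close>. It remains to control \<open>F\<close>.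

  The generating function \<open>A = E[z^|T| exp(\<theta> F)]\<close> satisfies
  \<open>A = z \<phi>(A) + (exp \<theta> - 1) p z^|t|\<close> with \<open>\<phi>\<close> the generating function of \<open>\<nu>\<close>. As \<open>\<phi>(1) = 1\<close>, the
  choice \<open>z = 1 - p (exp \<theta> - 1)\<close> gives \<open>A \<le> 1\<close>, and Markov's inequality bounds
  \<open>P(|T| = n, |F - p n| \<ge> \<epsilon> n)\<close> exponentially.

  Conditioning costs only a subexponential factor: by the cycle lemma
  \<open>n P(|T| = n) \<ge> P(S\<^sub>n = n - 1)\<close> for a sum \<open>S\<^sub>n\<close> of \<open>n\<close> independent offspring numbers. By Chebyshev's
  inequality some value close to \<open>m\<close> is taken by \<open>S\<^sub>m\<close> with probability at least \<open>1 / (4 m + 2)\<close>, and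
  a small proportion \<open>n - m\<close> of further steps suffices to correct it to \<open>n - 1\<close>.
\<close>

section \<open>Plane trees as a datatype\<close>

text \<open>Finite plane trees become a datatype, so that facts about them go by structural
  induction; \<open>words\<close> translates them back into sets of words.\<close>

datatype ptree = Node (subtrees: "ptree list")

primrec is_word :: "nat list \<Rightarrow> ptree \<Rightarrow> bool" where
  "is_word [] \<tau> = True"
| "is_word (i # u) \<tau> = (i < length (subtrees \<tau>) \<and> is_word u (subtrees \<tau> ! i))"

text \<open>An out-of-range letter leads to an unspecified subtree, so the value is meaningful only
  at words of \<open>words \<tau>\<close>.\<close>

primrec tree_at :: "nat list \<Rightarrow> ptree \<Rightarrow> ptree" where
  "tree_at [] \<tau> = \<tau>"
| "tree_at (i # u) \<tau> = tree_at u (subtrees \<tau> ! i)"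

definition words :: "ptree \<Rightarrow> word_tree" where
  "words \<tau> = {u. is_word u \<tau>}"

definition deg :: "ptree \<Rightarrow> nat list \<Rightarrow> nat" where
  "deg \<tau> u = length (subtrees (tree_at u \<tau>))"

abbreviation tsize :: "ptree \<Rightarrow> nat" where
  "tsize \<tau> \<equiv> card (words \<tau>)"

lemma words_Node: "words (Node ts) = insert [] (\<Union>i<length ts. (#) i ` words (ts ! i))"
proof (rule set_eqI)
  fix u show "u \<in> words (Node ts) \<longleftrightarrow> u \<in> insert [] (\<Union>i<length ts. (#) i ` words (ts ! i))"
    by (cases u) (auto simp: words_def)
qed

lemma Nil_in_words [simp]: "[] \<in> words \<tau>"
  by (simp add: words_def)

lemma Cons_in_words [simp]: "i # u \<in> words (Node ts) \<longleftrightarrow> i < length ts \<and> u \<in> words (ts ! i)"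
  by (simp add: words_def)

lemma deg_Node [simp]: "deg (Node ts) [] = length ts" "deg (Node ts) (i # u) = deg (ts ! i) u"
  by (simp_all add: deg_def)

lemma finite_words [simp]: "finite (words \<tau>)"
  by (induction \<tau>) (auto simp: words_Node)

lemma prod_words_Node:
  "(\<Prod>u\<in>words (Node ts). g u) = g [] * (\<Prod>i<length ts. \<Prod>u\<in>words (ts ! i). g (i # u))"
proof -
  have "(\<Prod>u\<in>(\<Union>i<length ts. (#) i ` words (ts ! i)). g u)
      = (\<Prod>i<length ts. \<Prod>u\<in>(#) i ` words (ts ! i). g u)"
    by (rule prod.UNION_disjoint) auto
  then show ?thesis
    by (subst words_Node, subst prod.insert) (auto simp: prod.reindex)
qed

lemma sum_words_Node:
  "(\<Sum>u\<in>words (Node ts). g u) = g [] + (\<Sum>i<length ts. \<Sum>u\<in>words (ts ! i). g (i # u))"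
proof -
  have "(\<Sum>u\<in>(\<Union>i<length ts. (#) i ` words (ts ! i)). g u)
      = (\<Sum>i<length ts. \<Sum>u\<in>(#) i ` words (ts ! i). g u)"
    by (rule sum.UNION_disjoint) auto
  then show ?thesis
    by (subst words_Node, subst sum.insert) (auto simp: sum.reindex)
qed

lemma tsize_Node: "tsize (Node ts) = Suc (sum_list (map tsize ts))"
  using sum_words_Node[of "\<lambda>_. 1 :: nat" ts]
  by (simp add: sum_list_sum_nth atLeast0LessThan)

lemma append_in_words: "u @ v \<in> words \<tau> \<longleftrightarrow> u \<in> words \<tau> \<and> v \<in> words (tree_at u \<tau>)"
  by (induction u arbitrary: \<tau>) (auto simp: words_def)

lemma snoc_in_words: "u @ [i] \<in> words \<tau> \<longleftrightarrow> u \<in> words \<tau> \<and> i < deg \<tau> u"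
  by (subst append_in_words) (auto simp: words_def deg_def)

text \<open>The one-letter words determine the number of children of the root, and stripping a first
  letter \<open>i\<close> gives the words of the subtree number \<open>i\<close>.\<close>

lemma words_inject: "words \<tau> = words \<tau>' \<longleftrightarrow> \<tau> = \<tau>'"
proof
  show "words \<tau> = words \<tau>' \<Longrightarrow> \<tau> = \<tau>'"
  proof (induction \<tau> arbitrary: \<tau>')
    case (Node ts)
    obtain ts' where [simp]: "\<tau>' = Node ts'" by (cases \<tau>')
    have *: "i < length ts \<and> u \<in> words (ts ! i) \<longleftrightarrow> i < length ts' \<and> u \<in> words (ts' ! i)" for i u
      using Node.prems Cons_in_words[of i u ts] Cons_in_words[of i u ts'] by simp
    have less_iff: "i < length ts \<longleftrightarrow> i < length ts'" for i
      using *[of i "[]"] by simp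
    have len: "length ts = length ts'"
      using less_iff[of "length ts"] less_iff[of "length ts'"] by simp
    have "ts ! i = ts' ! i" if i: "i < length ts" for i
    proof (rule Node.IH)
      show "words (ts ! i) = words (ts' ! i)"
        using *[of i] i len by (intro set_eqI) simp
    qed (use i in simp)
    with len show ?case by (simp add: nth_equalityI)
  qed
qed simp

lemma finite_down_closed_nat:
  fixes S :: "nat set"
  assumes "finite S" "\<And>i j. i \<in> S \<Longrightarrow> j < i \<Longrightarrow> j \<in> S"
  shows "\<exists>n. S = {..<n}"
proof (cases "S = {}")
  case False
  have "S = {..<Suc (Max S)}"
  proof (intro equalityI subsetI)
    fix x assume "x \<in> {..<Suc (Max S)}"
    then have "x = Max S \<or> x < Max S" by auto
    then show "x \<in> S" using assms False Max_in by blast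
  qed (use assms in \<open>auto simp: less_Suc_eq_le\<close>)
  then show ?thesis by blast
qed auto

text \<open>Cutting \<open>t\<close> below each child of the root gives smaller word trees, to which
  induction on the cardinality applies. Closure to the left makes the first letters an initial
  segment, so the subtrees form a list.\<close>

lemma finite_word_tree_words:
  assumes "finite_word_tree t"
  shows "\<exists>\<tau>. words \<tau> = t"
  using assms
proof (induction "card t" arbitrary: t rule: less_induct)
  case less
  have t: "finite t" "[] \<in> t" and up: "\<And>w i. w @ [i] \<in> t \<Longrightarrow> w \<in> t"
    and left: "\<And>w i j. w @ [i] \<in> t \<Longrightarrow> j < i \<Longrightarrow> w @ [j] \<in> t"
    using less.prems unfolding finite_word_tree_def by blast+
  have pre: "u @ v \<in> t \<Longrightarrow> u \<in> t" for u v
    by (induction v rule: rev_induct) (auto simp flip: append_assoc dest: up)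
  have inj: "inj_on ((#) i) A" for i :: nat and A by auto
  have "finite {i. [i] \<in> t}"
    using finite_vimageI[of t "\<lambda>i. [i]"] t by (auto simp: vimage_def inj_def)
  moreover have "[i] \<in> t \<Longrightarrow> j < i \<Longrightarrow> [j] \<in> t" for i j
    using left[of "[]"] by simp
  ultimately obtain n where n: "{i. [i] \<in> t} = {..<n}"
    using finite_down_closed_nat[of "{i. [i] \<in> t}"] by auto
  have "\<exists>\<tau>. words \<tau> = {u. i # u \<in> t}" if "i < n" for i
  proof (rule less.hyps)
    have fin: "finite {u. i # u \<in> t}"
      using finite_vimageI[of t "(#) i"] t by (auto simp: vimage_def)
    have "card {u. i # u \<in> t} = card ((#) i ` {u. i # u \<in> t})"
      by (simp add: card_image)
    \<comment> \<open>The prefixed copy lies in \<open>t\<close> and misses the empty word.\<close>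
    also have "\<dots> < card t"
      using t by (intro psubset_card_mono) (auto simp: psubset_eq)
    finally show "card {u. i # u \<in> t} < card t" .
    have "[i] \<in> t" using that n by auto
    moreover have "i # u @ [j] \<in> t \<Longrightarrow> i # u \<in> t" for u j
      using up[of "i # u"] by simp
    moreover have "i # u @ [j] \<in> t \<Longrightarrow> j' < j \<Longrightarrow> i # u @ [j'] \<in> t" for u j j'
      using left[of "i # u"] by simp
    ultimately show "finite_word_tree {u. i # u \<in> t}"
      using fin unfolding finite_word_tree_def by simp
  qed
  then obtain f where f: "\<And>i. i < n \<Longrightarrow> words (f i) = {u. i # u \<in> t}" by metis
  have "words (Node (map f [0..<n])) = t"
  proof (rule set_eqI)
    fix u show "u \<in> words (Node (map f [0..<n])) \<longleftrightarrow> u \<in> t"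
    proof (cases u)
      case (Cons i v)
      have "i # v \<in> t \<Longrightarrow> i < n"
        using pre[of "[i]" v] n by auto
      then show ?thesis using Cons f by auto
    qed (use t in simp)
  qed
  then show ?case by blast
qed

text \<open>The probability that the Galton--Watson tree equals \<open>\<tau>\<close>; see
  \<open>measure_verts_GW_tree\<close>.\<close>

definition weight :: "nat pmf \<Rightarrow> ptree \<Rightarrow> real" where
  "weight \<nu> \<tau> = (\<Prod>u\<in>words \<tau>. pmf \<nu> (deg \<tau> u))"

definition occ :: "ptree \<Rightarrow> ptree \<Rightarrow> nat" where
  "occ \<sigma> \<tau> = card {u \<in> words \<tau>. tree_at u \<tau> = \<sigma>}"

definition level_card :: "nat \<Rightarrow> ptree \<Rightarrow> nat" where
  "level_card k \<tau> = card {u \<in> words \<tau>. length u = k}"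

lemma weight_nonneg [simp]: "0 \<le> weight \<nu> \<tau>"
  by (simp add: weight_def prod_nonneg)

lemma weight_Node_nth:
  "weight \<nu> (Node ts) = pmf \<nu> (length ts) * (\<Prod>i<length ts. weight \<nu> (ts ! i))"
  by (simp add: weight_def prod_words_Node)

lemma prod_list_map_conv_nth: "prod_list (map f xs) = (\<Prod>i<length xs. f (xs ! i))"
  by (induction xs) (simp_all add: prod.lessThan_Suc_shift del: prod.lessThan_Suc)

lemma weight_Node: "weight \<nu> (Node ts) = pmf \<nu> (length ts) * prod_list (map (weight \<nu>) ts)"
  by (simp add: weight_Node_nth prod_list_map_conv_nth)

lemma card_Collect_conv_sum:
  "finite A \<Longrightarrow> card {x \<in> A. P x} = (\<Sum>x\<in>A. of_bool (P x))"
  by (simp add: sum.If_cases Int_def of_bool_def)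

lemma occ_Node: "occ \<sigma> (Node ts) = of_bool (Node ts = \<sigma>) + sum_list (map (occ \<sigma>) ts)"
  by (simp add: occ_def card_Collect_conv_sum sum_words_Node sum_list_sum_nth atLeast0LessThan)

lemma level_card_Suc_Node:
  "level_card (Suc k) (Node ts) = (\<Sum>i<length ts. level_card k (ts ! i))"
  by (simp add: level_card_def card_Collect_conv_sum sum_words_Node)

lemma level_card_0 [simp]: "level_card 0 \<tau> = 1"
proof -
  have "{u \<in> words \<tau>. length u = 0} = {[]}" by auto
  then show ?thesis by (simp add: level_card_def)
qed

section \<open>Finite Galton--Watson trees as values of the datatype\<close>

lemma snoc_in_verts_GW_tree:
  "v @ [i] \<in> verts (GW_tree \<omega>) \<longleftrightarrow> v \<in> verts (GW_tree \<omega>) \<and> i < \<omega> v"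
  by (auto simp: GW_tree_def nth_append less_Suc_eq)

text \<open>Turns the event of a prescribed shape into a cylinder event: only the offspring numbers
  at the finitely many vertices of \<open>\<tau>\<close> are fixed.\<close>

lemma verts_GW_tree_eq_words:
  "verts (GW_tree \<omega>) = words \<tau> \<longleftrightarrow> (\<forall>u\<in>words \<tau>. \<omega> u = deg \<tau> u)"
proof (intro iffI ballI)
  fix u assume eq: "verts (GW_tree \<omega>) = words \<tau>" and u: "u \<in> words \<tau>"
  have "i < \<omega> u \<longleftrightarrow> i < deg \<tau> u" for i
    using snoc_in_verts_GW_tree[of u i \<omega>] snoc_in_words[of u i \<tau>] eq u by simp
  from this[of "\<omega> u"] this[of "deg \<tau> u"] show "\<omega> u = deg \<tau> u" by simp
next
  assume *: "\<forall>u\<in>words \<tau>. \<omega> u = deg \<tau> u"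
  have "u \<in> verts (GW_tree \<omega>) \<longleftrightarrow> u \<in> words \<tau>" for u
  proof (induction u rule: rev_induct)
    case (snoc i u)
    then show ?case using * by (auto simp: snoc_in_verts_GW_tree snoc_in_words)
  qed (simp add: GW_tree_def)
  then show "verts (GW_tree \<omega>) = words \<tau>" by blast
qed

lemma finite_verts_GW_tree:
  assumes "finite (verts (GW_tree \<omega>))"
  shows "\<exists>\<tau>. verts (GW_tree \<omega>) = words \<tau>"
proof -
  have "finite_word_tree (verts (GW_tree \<omega>))"
    unfolding finite_word_tree_def using assms
    by (auto simp: snoc_in_verts_GW_tree) (simp add: GW_tree_def)
  then show ?thesis using finite_word_tree_words by metis
qed

lemma ancestor_GW_tree:
  assumes "u \<in> verts (GW_tree \<omega>)"
  shows "ancestor (GW_tree \<omega>) u k = (if k \<le> length u then Some (take (length u - k) u) else None)"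
proof (induction k)
  case (Suc k)
  have root: "parent (GW_tree \<omega>) [] = None"
    by (auto simp: parent_def GW_tree_def)
  have pre: "v @ w \<in> verts (GW_tree \<omega>) \<Longrightarrow> v \<in> verts (GW_tree \<omega>)" for v w
    by (induction w rule: rev_induct) (auto simp: snoc_in_verts_GW_tree simp flip: append_assoc)
  show ?case
  proof (cases "k < length u")
    case True
    define j where "j = length u - Suc k"
    have j: "j < length u" "length u - k = Suc j" using True by (auto simp: j_def)
    have "take (Suc j) u \<in> verts (GW_tree \<omega>)"
      using pre[of "take (Suc j) u" "drop (Suc j) u"] assms by simp
    then have "parent (GW_tree \<omega>) (take (Suc j) u) = Some (take j u)"
      using j parent_GW_tree by (simp add: take_Suc_conv_app_nth)
    then show ?thesis using Suc True j by (simp add: j_def)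
  next
    case False
    then show ?thesis using Suc root by (auto simp: le_Suc_eq)
  qed
qed simp

text \<open>A vertex \<open>x\<close> that is counted splits uniquely as \<open>u @ v\<close>, where
  \<open>u\<close> is the root of a copy of \<open>\<sigma>\<close> and \<open>v\<close> is a vertex
  of \<open>\<sigma>\<close> of height \<open>k\<close>. The count is therefore a product.\<close>

lemma sum_H_GW_tree:
  assumes eq: "verts (GW_tree \<omega>) = words \<tau>"
  shows "(\<Sum>x\<in>verts (GW_tree \<omega>). of_bool (H k (GW_tree \<omega>) x = Some (words \<sigma>)))
    = real (level_card k \<sigma> * occ \<sigma> \<tau>)"
proof -
  have Top: "Top (GW_tree \<omega>) u = words (tree_at u \<tau>)" if "u \<in> words \<tau>" for u
    using that Top_GW_tree[of u \<omega>] by (auto simp: eq append_in_words)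
  let ?U = "{u \<in> words \<tau>. tree_at u \<tau> = \<sigma>}" and ?V = "{v \<in> words \<sigma>. length v = k}"
  have "{x \<in> words \<tau>. H k (GW_tree \<omega>) x = Some (words \<sigma>)} = (\<lambda>(u, v). u @ v) ` (?U \<times> ?V)"
  proof (intro equalityI subsetI)
    fix x assume "x \<in> {x \<in> words \<tau>. H k (GW_tree \<omega>) x = Some (words \<sigma>)}"
    then have x: "x \<in> words \<tau>" and Hx: "H k (GW_tree \<omega>) x = Some (words \<sigma>)" by auto
    let ?u = "take (length x - k) x" and ?v = "drop (length x - k) x"
    have k: "k \<le> length x"
      using Hx x by (auto simp: H_def ancestor_GW_tree eq split: if_splits)
    have uv: "?u \<in> words \<tau>" "?v \<in> words (tree_at ?u \<tau>)"
      using x append_in_words[of ?u ?v \<tau>] by auto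
    have "tree_at ?u \<tau> = \<sigma>"
      using Hx x k uv(1) by (auto simp: H_def ancestor_GW_tree eq Top words_inject)
    then have "(?u, ?v) \<in> ?U \<times> ?V" using uv k by auto
    moreover have "x = (\<lambda>(u, v). u @ v) (?u, ?v)" by simp
    ultimately show "x \<in> (\<lambda>(u, v). u @ v) ` (?U \<times> ?V)" by blast
  next
    fix x assume "x \<in> (\<lambda>(u, v). u @ v) ` (?U \<times> ?V)"
    then show "x \<in> {x \<in> words \<tau>. H k (GW_tree \<omega>) x = Some (words \<sigma>)}"
      by (auto simp: append_in_words H_def ancestor_GW_tree eq Top)
  qed
  moreover have "inj_on (\<lambda>(u, v). u @ v) (?U \<times> ?V)"
    by (auto simp: inj_on_def)
  ultimately have "card {x \<in> words \<tau>. H k (GW_tree \<omega>) x = Some (words \<sigma>)} = occ \<sigma> \<tau> * level_card k \<sigma>"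
    by (simp add: card_image card_cartesian_product occ_def level_card_def)
  moreover have "(\<Sum>x\<in>verts (GW_tree \<omega>). of_bool (H k (GW_tree \<omega>) x = Some (words \<sigma>)))
      = real (card {x \<in> words \<tau>. H k (GW_tree \<omega>) x = Some (words \<sigma>)})"
    by (simp add: card_Collect_conv_sum eq)
  ultimately show ?thesis by simp
qed

section \<open>Exponential moments of subtree counts\<close>

text \<open>Truncation by size keeps every generating function a finite sum, so no convergence
  question arises; the estimates are proved for each \<open>n\<close>.\<close>

definition trees :: "nat \<Rightarrow> ptree set" where
  "trees n = {\<tau>. tsize \<tau> \<le> n}"

lemma tsize_pos: "0 < tsize \<tau>"
  using Nil_in_words[of \<tau>] finite_words[of \<tau>] card_gt_0_iff by blast

lemma tsize_le_sum_list: "\<tau> \<in> set ts \<Longrightarrow> tsize \<tau> \<le> sum_list (map tsize ts)"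
  by (induction ts) auto

lemma length_le_sum_tsize: "length ts \<le> sum_list (map tsize ts)"
proof (induction ts)
  case (Cons a ts)
  then show ?case using tsize_pos[of a] by simp
qed simp

lemma trees_0 [simp]: "trees 0 = {}"
  by (simp add: trees_def less_imp_neq[OF tsize_pos, symmetric] del: card_eq_0_iff)

text \<open>A proper inclusion in general, since the sizes of the subtrees are bounded one by one
  and not jointly. Hence the recursion below is an inequality.\<close>

lemma trees_Suc_subset:
  "trees (Suc n) \<subseteq> Node ` (\<Union>k\<le>n. {ts. set ts \<subseteq> trees n \<and> length ts = k})"
proof
  fix \<tau> assume *: "\<tau> \<in> trees (Suc n)"
  obtain ts where ts: "\<tau> = Node ts" by (cases \<tau>)
  have "sum_list (map tsize ts) \<le> n" using * by (simp add: trees_def ts tsize_Node)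
  then have "set ts \<subseteq> trees n" "length ts \<le> n"
    using tsize_le_sum_list length_le_sum_tsize order_trans by (fastforce simp: trees_def)+
  then show "\<tau> \<in> Node ` (\<Union>k\<le>n. {ts. set ts \<subseteq> trees n \<and> length ts = k})"
    by (auto simp: ts)
qed

lemma finite_trees [simp]: "finite (trees n)"
proof (induction n)
  case (Suc n)
  then show ?case
    by (intro finite_subset[OF trees_Suc_subset] finite_imageI finite_UN_I finite_lists_length_eq) auto
qed simp

lemma sum_prod_list_power:
  fixes f :: "'a \<Rightarrow> 'b::comm_semiring_1"
  assumes "finite A"
  shows "(\<Sum>xs | set xs \<subseteq> A \<and> length xs = n. prod_list (map f xs)) = (\<Sum>x\<in>A. f x) ^ n"
proof (induction n)
  case 0
  have "{xs. set xs \<subseteq> A \<and> length xs = 0} = {[]}" by auto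
  then show ?case by simp
next
  case (Suc n)
  let ?L = "{xs. set xs \<subseteq> A \<and> length xs = n}"
  have eq: "{xs. set xs \<subseteq> A \<and> length xs = Suc n} = (\<lambda>(x, xs). x # xs) ` (A \<times> ?L)"
    by (auto simp: length_Suc_conv)
  have "inj_on (\<lambda>(x, xs). x # xs) (A \<times> ?L)" by (auto simp: inj_on_def)
  then have "(\<Sum>xs | set xs \<subseteq> A \<and> length xs = Suc n. prod_list (map f xs))
      = (\<Sum>(x, xs)\<in>A \<times> ?L. f x * prod_list (map f xs))"
    unfolding eq by (subst sum.reindex) (auto simp: case_prod_unfold)
  also have "\<dots> = (\<Sum>x\<in>A. f x) * (\<Sum>xs\<in>?L. prod_list (map f xs))"
    by (simp add: sum_product sum.cartesian_product)
  finally show ?case using Suc by simp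
qed

lemma tsize_tree_at_le: "u \<in> words \<tau> \<Longrightarrow> tsize (tree_at u \<tau>) \<le> tsize \<tau>"
  by (rule card_inj_on_le[of "(@) u"]) (auto simp: inj_on_def append_in_words)

lemma occ_eq_0: "tsize \<tau> < tsize \<sigma> \<Longrightarrow> occ \<sigma> \<tau> = 0"
  using tsize_tree_at_le by (fastforce simp: occ_def)

text \<open>Proper subtrees are strictly smaller, so only the root contributes.\<close>

lemma occ_self: "occ \<sigma> \<sigma> = 1"
proof (cases \<sigma>)
  case (Node ts)
  have "occ \<sigma> \<tau> = 0" if "\<tau> \<in> set ts" for \<tau>
    using tsize_le_sum_list[OF that] by (intro occ_eq_0) (simp add: Node tsize_Node)
  then show ?thesis
    by (simp add: Node occ_Node cong: map_cong)
qed

lemma sum_pmf_le_1: "finite A \<Longrightarrow> (\<Sum>k\<in>A. pmf p k) \<le> 1"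
  by (metis measure_measure_pmf_finite measure_pmf.prob_le_1)

text \<open>The contribution of \<open>\<tau>\<close> to the generating function \<open>A\<close>:
  \<open>z\<close> marks vertices and \<open>exp \<theta>\<close> marks copies of
  \<open>\<sigma>\<close>.\<close>

definition tilted :: "nat pmf \<Rightarrow> ptree \<Rightarrow> real \<Rightarrow> real \<Rightarrow> ptree \<Rightarrow> real" where
  "tilted \<nu> \<sigma> \<theta> z \<tau> = weight \<nu> \<tau> * z ^ tsize \<tau> * exp (\<theta> * occ \<sigma> \<tau>)"

lemma tilted_nonneg: "0 \<le> z \<Longrightarrow> 0 \<le> tilted \<nu> \<sigma> \<theta> z \<tau>"
  by (simp add: tilted_def)

lemma tilted_Node:
  "tilted \<nu> \<sigma> \<theta> z (Node ts) =
     pmf \<nu> (length ts) * z * prod_list (map (tilted \<nu> \<sigma> \<theta> z) ts) * exp (\<theta> * of_bool (Node ts = \<sigma>))"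
proof -
  have "prod_list (map (weight \<nu>) ts) * z ^ sum_list (map tsize ts)
      * exp (\<theta> * real (sum_list (map (occ \<sigma>) ts))) = prod_list (map (tilted \<nu> \<sigma> \<theta> z) ts)"
    by (induction ts) (simp_all add: tilted_def power_add ring_distribs exp_add)
  then show ?thesis
    by (simp add: tilted_def[of _ _ _ _ "Node ts"] weight_Node tsize_Node occ_Node ring_distribs exp_add)
qed

text \<open>The functional equation for \<open>A\<close>, truncated by size. In \<open>g\<close> a
  copy of \<open>\<sigma>\<close> at the root is not counted, so its sum factorises over the
  subtrees; restoring the factor \<open>exp \<theta>\<close> at the single tree
  \<open>\<sigma>\<close> produces the last term.\<close>

lemma sum_tilted_Suc:
  assumes z: "0 \<le> z"
  shows "(\<Sum>\<tau>\<in>trees (Suc n). tilted \<nu> \<sigma> \<theta> z \<tau>)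
    \<le> z * (\<Sum>k\<le>n. pmf \<nu> k * (\<Sum>\<tau>\<in>trees n. tilted \<nu> \<sigma> \<theta> z \<tau>) ^ k)
      + of_bool (tsize \<sigma> \<le> Suc n) * ((exp \<theta> - 1) * (weight \<nu> \<sigma> * z ^ tsize \<sigma>))"
proof -
  let ?f = "tilted \<nu> \<sigma> \<theta> z"
  let ?L = "\<lambda>k. {ts. set ts \<subseteq> trees n \<and> length ts = k}"
  define g where "g \<tau> = pmf \<nu> (length (subtrees \<tau>)) * z * prod_list (map ?f (subtrees \<tau>))" for \<tau>
  have g_nonneg: "0 \<le> g \<tau>" for \<tau>
    using z by (auto simp: g_def intro!: mult_nonneg_nonneg prod_list_nonneg tilted_nonneg)
  have fg: "?f \<tau> = g \<tau> * exp (\<theta> * of_bool (\<tau> = \<sigma>))" for \<tau>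
    by (cases \<tau>) (simp only: tilted_Node g_def ptree.sel)
  \<comment> \<open>By \<open>occ_self\<close> the only copy of \<open>\<sigma>\<close> in itself
    sits at the root, so \<open>g \<sigma>\<close> carries no power of
    \<open>exp \<theta>\<close>.\<close>
  have "exp \<theta> * g \<sigma> = exp \<theta> * (weight \<nu> \<sigma> * z ^ tsize \<sigma>)"
    using fg[of \<sigma>] by (simp add: tilted_def occ_self)
  then have g\<sigma>: "g \<sigma> = weight \<nu> \<sigma> * z ^ tsize \<sigma>"
    by simp
  have fg': "?f \<tau> = g \<tau> + (if \<tau> = \<sigma> then (exp \<theta> - 1) * (weight \<nu> \<sigma> * z ^ tsize \<sigma>) else 0)" for \<tau>
    using fg[of \<tau>] g\<sigma> by (simp add: algebra_simps)
  have fin: "finite (\<Union>k\<le>n. ?L k)" by (auto intro: finite_lists_length_eq)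
  have "(\<Sum>\<tau>\<in>trees (Suc n). g \<tau>) \<le> (\<Sum>\<tau>\<in>Node ` (\<Union>k\<le>n. ?L k). g \<tau>)"
    by (rule sum_mono2[OF finite_imageI[OF fin] trees_Suc_subset g_nonneg])
  also have "\<dots> = (\<Sum>ts\<in>(\<Union>k\<le>n. ?L k). g (Node ts))"
    by (subst sum.reindex) (auto simp: inj_on_def)
  also have "\<dots> = (\<Sum>k\<le>n. \<Sum>ts\<in>?L k. g (Node ts))"
    by (rule sum.UNION_disjoint) (auto intro: finite_lists_length_eq)
  also have "\<dots> = (\<Sum>k\<le>n. pmf \<nu> k * z * (\<Sum>ts\<in>?L k. prod_list (map ?f ts)))"
    by (simp add: g_def sum_distrib_left)
  also have "\<dots> = z * (\<Sum>k\<le>n. pmf \<nu> k * (\<Sum>\<tau>\<in>trees n. ?f \<tau>) ^ k)"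
    by (simp add: sum_prod_list_power sum_distrib_left mult_ac)
  finally have "(\<Sum>\<tau>\<in>trees (Suc n). g \<tau>) \<le> z * (\<Sum>k\<le>n. pmf \<nu> k * (\<Sum>\<tau>\<in>trees n. ?f \<tau>) ^ k)" .
  moreover have "(\<Sum>\<tau>\<in>trees (Suc n). ?f \<tau>) = (\<Sum>\<tau>\<in>trees (Suc n). g \<tau>)
      + of_bool (tsize \<sigma> \<le> Suc n) * ((exp \<theta> - 1) * (weight \<nu> \<sigma> * z ^ tsize \<sigma>))"
    unfolding fg' sum.distrib by (subst sum.delta[OF finite_trees]) (simp add: trees_def)
  ultimately show ?thesis by linarith
qed

text \<open>This is where the mass \<open>\<Sum>k. pmf \<nu> k = 1\<close> makes \<open>1\<close> a supersolution of the recursion.\<close>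

lemma sum_tilted_Suc_le:
  assumes z: "0 \<le> z" and le: "(\<Sum>\<tau>\<in>trees n. tilted \<nu> \<sigma> \<theta> z \<tau>) \<le> 1"
  shows "(\<Sum>\<tau>\<in>trees (Suc n). tilted \<nu> \<sigma> \<theta> z \<tau>)
    \<le> z + of_bool (tsize \<sigma> \<le> Suc n) * ((exp \<theta> - 1) * (weight \<nu> \<sigma> * z ^ tsize \<sigma>))"
proof -
  let ?A = "\<Sum>\<tau>\<in>trees n. tilted \<nu> \<sigma> \<theta> z \<tau>"
  have "0 \<le> ?A" by (intro sum_nonneg tilted_nonneg z)
  then have "(\<Sum>k\<le>n. pmf \<nu> k * ?A ^ k) \<le> (\<Sum>k\<le>n. pmf \<nu> k)"
    using le by (intro sum_mono mult_left_le power_le_one) auto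
  also have "\<dots> \<le> 1" by (simp add: sum_pmf_le_1)
  finally have "z * (\<Sum>k\<le>n. pmf \<nu> k * ?A ^ k) \<le> z"
    using z mult_left_le by blast
  then show ?thesis using sum_tilted_Suc[OF z, where \<nu>=\<nu> and \<sigma>=\<sigma> and \<theta>=\<theta> and n=n] by linarith
qed

text \<open>The generating function of \<open>\<nu>\<close> lies below the chord from
  \<open>(0, pmf \<nu> 0)\<close> to \<open>(1, 1)\<close> and thus maps numbers below
  \<open>1\<close> to numbers below \<open>1\<close>. The strict inequality starts the induction in
  \<open>occ_lower_tail\<close>.\<close>

lemma sum_weight_trees_less_1:
  assumes "pmf \<nu> 0 < 1"
  shows "(\<Sum>\<tau>\<in>trees n. weight \<nu> \<tau>) < 1"
proof (induction n)
  case (Suc n)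
  let ?Q = "\<Sum>\<tau>\<in>trees n. weight \<nu> \<tau>"
  have Q: "0 \<le> ?Q" by (intro sum_nonneg) simp
  have "(\<Sum>\<tau>\<in>trees (Suc n). weight \<nu> \<tau>) \<le> (\<Sum>k\<le>n. pmf \<nu> k * ?Q ^ k)"
    \<comment> \<open>For \<open>z = 1\<close> and \<open>\<theta> = 0\<close> the term of
      \<open>\<sigma>\<close> vanishes, whatever \<open>\<sigma>\<close> is.\<close>
    using sum_tilted_Suc[of 1 \<nu> \<sigma> 0 n] by (simp add: tilted_def)
  also have "\<dots> \<le> (\<Sum>k\<le>n. pmf \<nu> k * (if k = 0 then 1 else ?Q))"
  proof (intro sum_mono mult_left_mono)
    fix k show "?Q ^ k \<le> (if k = 0 then 1 else ?Q)"
      using Q Suc by (cases k) (auto simp: mult_left_le power_le_one)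
  qed simp
  also have "\<dots> = pmf \<nu> 0 + ?Q * (\<Sum>k\<in>{1..n}. pmf \<nu> k)"
    by (simp add: sum.atMost_shift sum_distrib_left sum.atLeast1_atMost_eq mult.commute lessThan_Suc_atMost)
  also have "\<dots> \<le> pmf \<nu> 0 + ?Q * (1 - pmf \<nu> 0)"
  proof -
    have "pmf \<nu> 0 + (\<Sum>k\<in>{1..n}. pmf \<nu> k) \<le> 1"
      using sum_pmf_le_1[of "insert 0 {1..n}" \<nu>] by simp
    then show ?thesis using Q by (intro add_left_mono mult_left_mono) auto
  qed
  also have "\<dots> < 1"
  proof -
    have "?Q * (1 - pmf \<nu> 0) < 1 * (1 - pmf \<nu> 0)"
      using assms Suc by (intro mult_strict_right_mono) auto
    then show ?thesis by simp
  qed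
  finally show ?case .
qed simp

text \<open>Markov's inequality for the tilted weights. The factor \<open>\<theta>\<close> on both
  sides of the hypothesis on \<open>P\<close> serves both tails at once, because a negative
  \<open>\<theta>\<close> reverses the inequality.\<close>

lemma sum_weight_chernoff:
  assumes z: "0 < z" and le: "(\<Sum>\<tau>\<in>trees n. tilted \<nu> \<sigma> \<theta> z \<tau>) \<le> 1"
    and P: "\<And>\<tau>. P \<tau> \<Longrightarrow> \<theta> * a * n \<le> \<theta> * occ \<sigma> \<tau>"
  shows "(\<Sum>\<tau> | tsize \<tau> = n \<and> P \<tau>. weight \<nu> \<tau>) \<le> (exp (- \<theta> * a) / z) ^ n"
proof -
  have sub: "{\<tau>. tsize \<tau> = n \<and> P \<tau>} \<subseteq> trees n" by (auto simp: trees_def)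
  have "(\<Sum>\<tau> | tsize \<tau> = n \<and> P \<tau>. weight \<nu> \<tau>)
      \<le> (\<Sum>\<tau> | tsize \<tau> = n \<and> P \<tau>. (exp (- \<theta> * a) / z) ^ n * tilted \<nu> \<sigma> \<theta> z \<tau>)"
  proof (rule sum_mono)
    fix \<tau> assume *: "\<tau> \<in> {\<tau>. tsize \<tau> = n \<and> P \<tau>}"
    have "1 \<le> exp (\<theta> * occ \<sigma> \<tau> - \<theta> * a * n)"
      using P[of \<tau>] * by simp
    then have "weight \<nu> \<tau> \<le> weight \<nu> \<tau> * exp (\<theta> * occ \<sigma> \<tau> - \<theta> * a * n)"
      using mult_left_mono[of 1 _ "weight \<nu> \<tau>"] by simp
    also have "\<dots> = (exp (- \<theta> * a) / z) ^ n * tilted \<nu> \<sigma> \<theta> z \<tau>"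
    proof -
      have "(exp (- \<theta> * a) / z) ^ n * z ^ n = exp (- (\<theta> * a * n))"
        using z by (simp add: power_divide mult_ac flip: exp_of_nat_mult)
      moreover have "exp (\<theta> * occ \<sigma> \<tau> - \<theta> * a * n) = exp (- (\<theta> * a * n)) * exp (\<theta> * occ \<sigma> \<tau>)"
        by (simp flip: exp_add)
      ultimately show ?thesis using * by (simp add: tilted_def)
    qed
    finally show "weight \<nu> \<tau> \<le> (exp (- \<theta> * a) / z) ^ n * tilted \<nu> \<sigma> \<theta> z \<tau>" .
  qed
  also have "\<dots> \<le> (\<Sum>\<tau>\<in>trees n. (exp (- \<theta> * a) / z) ^ n * tilted \<nu> \<sigma> \<theta> z \<tau>)"
    using z by (intro sum_mono2 sub mult_nonneg_nonneg tilted_nonneg) auto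
  also have "\<dots> \<le> (exp (- \<theta> * a) / z) ^ n"
    using le z by (simp add: mult_left_le flip: sum_distrib_left)
  finally show ?thesis .
qed

section \<open>Exponential tail bounds for the number of copies\<close>

lemma power_le_exp:
  assumes "0 < r" "r < (1::real)"
  shows "\<exists>\<delta>>0. \<forall>n. r ^ n = exp (- \<delta> * real n)"
proof (intro exI[of _ "- ln r"] conjI allI)
  fix n show "r ^ n = exp (- (- ln r) * real n)"
    using assms by (simp add: mult.commute[of "ln r"] exp_of_nat_mult)
qed (use assms in simp)

text \<open>The base of the Chernoff bound is \<open>exp (- \<theta> * (p + \<epsilon>)) / z\<close>
  with \<open>z = 1 - p * (exp \<theta> - 1)\<close>. Numerator and denominator agree at
  \<open>\<theta> = 0\<close>, and a comparison of derivatives there makes the base less than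
  \<open>1\<close> for small positive \<open>\<theta>\<close>.\<close>

lemma occ_upper_tail:
  fixes \<epsilon> :: real
  assumes "0 < \<epsilon>"
  shows "\<exists>\<delta>>0. \<forall>n. (\<Sum>\<tau> | tsize \<tau> = n \<and> (weight \<nu> \<sigma> + \<epsilon>) * n \<le> occ \<sigma> \<tau>. weight \<nu> \<tau>)
    \<le> exp (- \<delta> * real n)"
proof -
  define p where "p = weight \<nu> \<sigma>"
  have p: "0 \<le> p" by (simp add: p_def)
  \<comment> \<open>The denominator minus the numerator of that base; \<open>h 0 = 0\<close> and the
    slope at \<open>0\<close> is \<open>\<epsilon>\<close>.\<close>
  define h where "h \<theta> = 1 - p * (exp \<theta> - 1) - exp (- \<theta> * (p + \<epsilon>))" for \<theta>
  have "(h has_real_derivative \<epsilon>) (at 0)"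
    unfolding h_def by (auto intro!: derivative_eq_intros)
  from DERIV_pos_inc_right[OF this assms] obtain d where d: "d > 0"
      "\<And>\<theta>. 0 < \<theta> \<Longrightarrow> \<theta> < d \<Longrightarrow> h 0 < h \<theta>" by auto
  define \<theta> where "\<theta> = d / 2"
  have \<theta>: "0 < \<theta>" "h 0 < h \<theta>" using d by (auto simp: \<theta>_def)
  define z where "z = 1 - p * (exp \<theta> - 1)"
  have z: "exp (- \<theta> * (p + \<epsilon>)) < z" "0 < z" "z \<le> 1"
    using \<theta> p exp_gt_zero[of "- \<theta> * (p + \<epsilon>)"] by (auto simp: h_def z_def simp del: exp_gt_zero)
  have "(\<Sum>\<tau>\<in>trees n. tilted \<nu> \<sigma> \<theta> z \<tau>) \<le> 1" for n
  proof (induction n)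
    case (Suc n)
    \<comment> \<open>As \<open>z \<le> 1\<close>, the term of \<open>\<sigma>\<close> is at most
      \<open>p * (exp \<theta> - 1) = 1 - z\<close>, just what the recursion leaves below
      \<open>1\<close>.\<close>
    have "of_bool (tsize \<sigma> \<le> Suc n) * ((exp \<theta> - 1) * (p * z ^ tsize \<sigma>)) \<le> 1 * ((exp \<theta> - 1) * (p * 1))"
      using z \<theta> p by (intro mult_mono) (auto intro: power_le_one)
    then show ?case
      using sum_tilted_Suc_le[OF _ Suc] z by (force simp: z_def p_def mult.commute)
  qed simp
  then have "(\<Sum>\<tau> | tsize \<tau> = n \<and> (p + \<epsilon>) * n \<le> occ \<sigma> \<tau>. weight \<nu> \<tau>)
      \<le> (exp (- \<theta> * (p + \<epsilon>)) / z) ^ n" for n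
    using \<theta> z by (intro sum_weight_chernoff) (auto simp: mult.assoc)
  moreover have "\<exists>\<delta>>0. \<forall>n. (exp (- \<theta> * (p + \<epsilon>)) / z) ^ n = exp (- \<delta> * real n)"
    using z by (intro power_le_exp) auto
  ultimately show ?thesis unfolding p_def by metis
qed

text \<open>The same scheme with \<open>\<theta> = - \<eta>\<close>, where now
  \<open>z = 1 + p * (1 - exp (- \<eta>))\<close> is at least \<open>1\<close>. In addition
  \<open>\<eta>\<close> has to be so small that \<open>z ^ m * Q < 1\<close>.\<close>

lemma occ_lower_tail:
  fixes \<epsilon> :: real
  assumes \<nu>0: "pmf \<nu> 0 < 1" and "0 < \<epsilon>"
  shows "\<exists>\<delta>>0. \<forall>n. (\<Sum>\<tau> | tsize \<tau> = n \<and> occ \<sigma> \<tau> \<le> (weight \<nu> \<sigma> - \<epsilon>) * n. weight \<nu> \<tau>)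
    \<le> exp (- \<delta> * real n)"
proof -
  define p where "p = weight \<nu> \<sigma>"
  have p: "0 \<le> p" by (simp add: p_def)
  define m where "m = tsize \<sigma>"
  have m: "0 < m" using tsize_pos by (simp add: m_def)
  define Q where "Q = (\<Sum>\<tau>\<in>trees (m - 1). weight \<nu> \<tau>)"
  have Q: "Q < 1" unfolding Q_def by (rule sum_weight_trees_less_1[OF \<nu>0])
  define h where "h \<eta> = 1 + p * (1 - exp (- \<eta>)) - exp (\<eta> * (p - \<epsilon>))" for \<eta>
  have "(h has_real_derivative \<epsilon>) (at 0)"
    unfolding h_def by (auto intro!: derivative_eq_intros)
  from DERIV_pos_inc_right[OF this assms(2)] obtain d where d: "d > 0"
      "\<And>\<eta>. 0 < \<eta> \<Longrightarrow> \<eta> < d \<Longrightarrow> h 0 < h \<eta>" by auto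
  then have ev1: "\<forall>\<^sub>F \<eta> in at_right 0. h 0 < h \<eta>"
    by (auto simp: eventually_at_right_field)
  have "((\<lambda>\<eta>. (1 + p * (1 - exp (- \<eta>))) ^ m * Q) \<longlongrightarrow> (1 + p * (1 - exp (- 0))) ^ m * Q) (at_right 0)"
    by (intro tendsto_intros)
  then have ev2: "\<forall>\<^sub>F \<eta> in at_right 0. (1 + p * (1 - exp (- \<eta>))) ^ m * Q < 1"
    using Q by (intro order_tendstoD(2)) auto
  have ev3: "\<forall>\<^sub>F \<eta> in at_right 0. (0::real) < \<eta>"
    by (simp add: eventually_at_right_less)
  obtain \<eta> where \<eta>: "0 < \<eta>" "h 0 < h \<eta>" "(1 + p * (1 - exp (- \<eta>))) ^ m * Q < 1"
    using eventually_happens'[OF _ eventually_conj[OF ev3 eventually_conj[OF ev1 ev2]]] by auto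
  define z where "z = 1 + p * (1 - exp (- \<eta>))"
  have z: "exp (\<eta> * (p - \<epsilon>)) < z" "1 \<le> z" "z ^ m * Q < 1"
    using \<eta> p by (auto simp: h_def z_def)
  \<comment> \<open>Since \<open>z > 1\<close>, the induction can only start once the term of \<open>\<sigma>\<close> compensates the factor
    \<open>z\<close>; up to size \<open>m - 1\<close> the strict inequality \<open>Q < 1\<close> leaves room for \<open>z ^ m\<close>.\<close>
  have *: "(\<Sum>\<tau>\<in>trees n. tilted \<nu> \<sigma> (- \<eta>) z \<tau>) \<le> 1" if "m - 1 \<le> n" for n
    using that
  proof (induction n rule: dec_induct)
    case base
    have "(\<Sum>\<tau>\<in>trees (m - 1). tilted \<nu> \<sigma> (- \<eta>) z \<tau>) \<le> (\<Sum>\<tau>\<in>trees (m - 1). z ^ m * weight \<nu> \<tau>)"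
    proof (rule sum_mono)
      fix \<tau> assume "\<tau> \<in> trees (m - 1)"
      then have "tsize \<tau> < m" using m by (auto simp: trees_def)
      moreover from this have "z ^ tsize \<tau> \<le> z ^ m" using z by (intro power_increasing) auto
      ultimately show "tilted \<nu> \<sigma> (- \<eta>) z \<tau> \<le> z ^ m * weight \<nu> \<tau>"
        by (simp add: tilted_def occ_eq_0 m_def mult.commute[of _ "weight \<nu> \<tau>"] mult_left_mono)
    qed
    then show ?case using z by (simp add: Q_def flip: sum_distrib_left)
  next
    case (step n)
    \<comment> \<open>The factor \<open>exp (- \<eta>) - 1\<close> is negative, so
      \<open>z ^ m \<ge> 1\<close> can only lower the term of \<open>\<sigma>\<close>, which then
      offsets the excess \<open>z - 1\<close>.\<close>
    have "(exp (- \<eta>) - 1) * (p * z ^ m) \<le> (exp (- \<eta>) - 1) * (p * 1)"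
      using z \<eta> p by (intro mult_left_mono_neg mult_left_mono one_le_power) auto
    moreover have "tsize \<sigma> \<le> Suc n" using step by (simp add: m_def)
    ultimately show ?case
      using sum_tilted_Suc_le[OF _ step.IH] z by (force simp: z_def p_def m_def algebra_simps)
  qed
  have "(\<Sum>\<tau>\<in>trees n. tilted \<nu> \<sigma> (- \<eta>) z \<tau>) \<le> 1" for n
  proof -
    have "(\<Sum>\<tau>\<in>trees n. tilted \<nu> \<sigma> (- \<eta>) z \<tau>) \<le> (\<Sum>\<tau>\<in>trees (max n (m - 1)). tilted \<nu> \<sigma> (- \<eta>) z \<tau>)"
      using z by (intro sum_mono2 tilted_nonneg finite_trees) (auto simp: trees_def)
    also have "\<dots> \<le> 1" by (rule *) simp
    finally show ?thesis .
  qed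
  then have "(\<Sum>\<tau> | tsize \<tau> = n \<and> occ \<sigma> \<tau> \<le> (p - \<epsilon>) * n. weight \<nu> \<tau>)
      \<le> (exp (- (- \<eta>) * (p - \<epsilon>)) / z) ^ n" for n
    using \<eta> z by (intro sum_weight_chernoff) (auto simp: mult.assoc)
  moreover have "\<exists>\<delta>>0. \<forall>n. (exp (- (- \<eta>) * (p - \<epsilon>)) / z) ^ n = exp (- \<delta> * real n)"
    using z by (intro power_le_exp) auto
  ultimately show ?thesis unfolding p_def by metis
qed

section \<open>Lower bound for the law of the size\<close>

text \<open>The Lukasiewicz word: the offspring numbers in depth-first order.\<close>

fun code :: "ptree \<Rightarrow> nat list" where
  "code (Node ts) = length ts # concat (map code ts)"

lemma length_code: "length (code \<tau>) = tsize \<tau>"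
  by (induction \<tau>) (simp add: tsize_Node length_concat comp_def cong: map_cong)

lemma prod_list_code: "prod_list (map (pmf \<nu>) (code \<tau>)) = weight \<nu> \<tau>"
proof (induction \<tau>)
  case (Node ts)
  then have "prod_list (map (pmf \<nu>) (concat (map code ts))) = prod_list (map (weight \<nu>) ts)"
    by (induction ts) simp_all
  then show ?case by (simp add: weight_Node)
qed

text \<open>Summing the offspring numbers counts every vertex except the root.\<close>

lemma sum_list_code: "Suc (sum_list (code \<tau>)) = length (code \<tau>)"
proof (induction \<tau>)
  case (Node ts)
  then have "length ts + sum_list (concat (map code ts)) = length (concat (map code ts))"
  proof (induction ts)
    case (Cons a ts)
    have "Suc (sum_list (code a)) = length (code a)" using Cons.prems by simp
    moreover have "length ts + sum_list (concat (map code ts)) = length (concat (map code ts))"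
      using Cons by simp
    ultimately show ?case by simp
  qed simp
  then show ?case by simp
qed

text \<open>The hypotheses say that the walk with steps \<open>x - 1\<close> started at
  \<open>k\<close> stays positive before the end and ends at \<open>0\<close>; its value is the
  number of trees still to be read. Such a list codes a forest of \<open>k\<close> trees.\<close>

lemma code_forest:
  assumes "\<And>j. j < length xs \<Longrightarrow> j < sum_list (take j xs) + k"
    and "sum_list xs + k = length xs"
  shows "\<exists>ts. length ts = k \<and> concat (map code ts) = xs"
  using assms
proof (induction xs arbitrary: k)
  case (Cons a ys)
  have "0 < k" using Cons.prems(1)[of 0] by simp
  then obtain k' where k: "k = Suc k'" by (cases k) auto
  \<comment> \<open>Reading \<open>a\<close> replaces one pending tree by its \<open>a\<close>
    subtrees; the first \<open>a\<close> trees found are regrouped below a common root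
    afterwards.\<close>
  have "\<exists>ts. length ts = k' + a \<and> concat (map code ts) = ys"
  proof (rule Cons.IH)
    fix j assume "j < length ys"
    then show "j < sum_list (take j ys) + (k' + a)"
      using Cons.prems(1)[of "Suc j"] k by simp
  qed (use Cons.prems(2) k in simp)
  then obtain ts where ts: "length ts = k' + a" "concat (map code ts) = ys" by blast
  have "concat (map code (Node (take a ts) # drop a ts))
      = a # concat (map code (take a ts @ drop a ts))"
    using ts(1) by (simp del: append_take_drop_id)
  then show ?case using ts k by (intro exI[of _ "Node (take a ts) # drop a ts"]) simp
qed simp

text \<open>Start reading at the first minimum of the walk with steps \<open>x - 1\<close>.\<close>

lemma code_cyclic_shift:
  assumes "Suc (sum_list xs) = length xs"
  shows "\<exists>i\<in>{1..length xs}. \<exists>\<tau>. code \<tau> = drop i xs @ take i xs"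
proof -
  define n where "n = length xs"
  define D where "D j = int (sum_list (take j xs)) - int j" for j
  have D0: "D 0 = 0" and Dn: "D n = -1"
    using assms by (simp_all add: D_def n_def)
  define M where "M = Min (D ` {..n})"
  have M_le: "M \<le> D j" if "j \<le> n" for j using that by (simp add: M_def)
  have "\<exists>i. i \<le> n \<and> D i = M"
    using Min_in[of "D ` {..n}"] unfolding M_def by fastforce
  then obtain i where i: "i \<le> n" "D i = M" and least: "\<And>l. l < i \<Longrightarrow> D l \<noteq> M"
    using exists_least_iff[of "\<lambda>i. i \<le> n \<and> D i = M"] by (metis less_or_eq_imp_le order_trans)
  \<comment> \<open>This leaves only \<open>n\<close> possible shifts, hence the factor
    \<open>n\<close> in \<open>sum_prob_le_sum_weight\<close>.\<close>
  have "i \<noteq> 0"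
  proof
    assume "i = 0"
    then show False using i M_le[of n] D0 Dn by simp
  qed
  \<comment> \<open>Positions before the wrap only need \<open>M \<le> D (i + j)\<close>. After the
    wrap the total drift \<open>D n = -1\<close> has been lost, and strictness before the first
    minimum makes up for it.\<close>
  have gt: "M < D l" if "l < i" for l
    using least[OF that] M_le[of l] that i by force
  let ?ys = "drop i xs @ take i xs"
  have split: "int (sum_list (take j (drop i xs))) = D (i + j) - D i + int j" for j
    by (simp add: D_def take_add)
  have "\<exists>ts. length ts = 1 \<and> concat (map code ts) = ?ys"
  proof (rule code_forest)
    fix j assume j: "j < length ?ys"
    then have jn: "j < n" using i by (simp add: n_def)
    show "j < sum_list (take j ?ys) + 1"
    proof (cases "j \<le> n - i")
      case True
      then have "take j ?ys = take j (drop i xs)" by (simp add: n_def)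
      moreover have "M \<le> D (i + j)" using True i by (intro M_le) simp
      ultimately show ?thesis using split[of j] i by simp
    next
      case False
      define l where "l = j - (n - i)"
      have l: "l < i" "j = (n - i) + l" using False jn i by (auto simp: l_def)
      have "take j ?ys = drop i xs @ take l xs"
        using False l i by (simp add: n_def min_def)
      moreover have "int (sum_list (drop i xs)) = D n - D i + int (n - i)"
        using split[of "n - i"] i by (simp add: n_def)
      moreover have "int (sum_list (take l xs)) = D l + int l" by (simp add: D_def)
      ultimately show ?thesis using gt[OF l(1)] l i Dn by simp
    qed
  next
    have "sum_list xs = sum_list (take i xs) + sum_list (drop i xs)"
      by (metis append_take_drop_id sum_list_append)
    then show "sum_list ?ys + 1 = length ?ys" using assms i by (simp add: n_def)
  qed
  then obtain \<tau> where "code \<tau> = ?ys" by (auto simp: length_Suc_conv)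
  then show ?thesis using i \<open>i \<noteq> 0\<close> by (auto simp: n_def intro!: bexI[of _ i])
qed

section \<open>Point probabilities of sums of independent offspring numbers\<close>

definition sum_prob :: "nat pmf \<Rightarrow> nat \<Rightarrow> nat \<Rightarrow> real" where
  "sum_prob \<nu> n c = (\<Sum>xs | length xs = n \<and> sum_list xs = c. prod_list (map (pmf \<nu>) xs))"

lemma finite_lists_length_sum: "finite {xs :: nat list. length xs = n \<and> sum_list xs = c}"
  by (rule finite_subset[OF _ finite_lists_length_eq[of "{..c}" n]])
     (auto intro: member_le_sum_list)

lemma prod_list_pmf_nonneg: "0 \<le> prod_list (map (pmf \<nu>) xs)"
  by (rule prod_list_nonneg) auto

lemma prod_list_le_sum_prob:
  "prod_list (map (pmf \<nu>) xs) \<le> sum_prob \<nu> (length xs) (sum_list xs)"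
  unfolding sum_prob_def
  by (rule member_le_sum) (auto simp: finite_lists_length_sum prod_list_pmf_nonneg)

lemma sum_prob_pos_iff:
  "0 < sum_prob \<nu> n c \<longleftrightarrow> (\<exists>xs. length xs = n \<and> sum_list xs = c \<and> set xs \<subseteq> set_pmf \<nu>)"
proof
  assume "0 < sum_prob \<nu> n c"
  then obtain xs where xs: "length xs = n" "sum_list xs = c" "prod_list (map (pmf \<nu>) xs) \<noteq> 0"
    unfolding sum_prob_def by (metis (mono_tags, lifting) less_irrefl mem_Collect_eq sum.neutral)
  then have "set xs \<subseteq> set_pmf \<nu>"
    by (auto simp: prod_list_zero_iff set_pmf_iff)
  then show "\<exists>xs. length xs = n \<and> sum_list xs = c \<and> set xs \<subseteq> set_pmf \<nu>" using xs by blast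
next
  assume "\<exists>xs. length xs = n \<and> sum_list xs = c \<and> set xs \<subseteq> set_pmf \<nu>"
  then obtain xs where xs: "length xs = n" "sum_list xs = c" "set xs \<subseteq> set_pmf \<nu>" by blast
  then have "prod_list (map (pmf \<nu>) xs) \<noteq> 0"
    by (auto simp: prod_list_zero_iff set_pmf_iff)
  then show "0 < sum_prob \<nu> n c"
    using prod_list_le_sum_prob[of \<nu> xs] prod_list_pmf_nonneg[of \<nu> xs] xs by simp
qed

text \<open>Reaching \<open>a\<close> after \<open>m\<close> steps and then adding \<open>b\<close>
  in \<open>n\<close> further steps is one way to reach \<open>a + b\<close>.\<close>

lemma sum_prob_add:
  "sum_prob \<nu> m a * sum_prob \<nu> n b \<le> sum_prob \<nu> (m + n) (a + b)"
proof -
  let ?L = "\<lambda>n c. {xs :: nat list. length xs = n \<and> sum_list xs = c}"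
  let ?p = "\<lambda>xs. prod_list (map (pmf \<nu>) xs)"
  have "sum_prob \<nu> m a * sum_prob \<nu> n b = (\<Sum>(xs, ys)\<in>?L m a \<times> ?L n b. ?p (xs @ ys))"
    by (simp add: sum_prob_def sum_product sum.cartesian_product)
  also have "\<dots> = (\<Sum>zs\<in>(\<lambda>(xs, ys). xs @ ys) ` (?L m a \<times> ?L n b). ?p zs)"
    by (subst sum.reindex) (auto simp: inj_on_def case_prod_unfold)
  also have "\<dots> \<le> sum_prob \<nu> (m + n) (a + b)"
    unfolding sum_prob_def
    by (rule sum_mono2) (auto simp: finite_lists_length_sum prod_list_pmf_nonneg)
  finally show ?thesis .
qed

lemma finite_tsize_eq [simp]: "finite {\<tau>. tsize \<tau> = n}"
  by (rule finite_subset[OF _ finite_trees[of n]]) (auto simp: trees_def)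

text \<open>Every list counted on the left is a rotation of the code of some tree, rotation
  preserves the product of the probabilities, and a tree has at most \<open>n\<close>
  rotations.\<close>

lemma sum_prob_le_sum_weight:
  assumes "0 < n"
  shows "sum_prob \<nu> n (n - 1) \<le> n * (\<Sum>\<tau> | tsize \<tau> = n. weight \<nu> \<tau>)"
proof -
  let ?p = "\<lambda>xs. prod_list (map (pmf \<nu>) xs)"
  let ?B = "{1..n} \<times> {\<tau>. tsize \<tau> = n}"
  \<comment> \<open>The inverse rotation: it recovers \<open>xs\<close> from
    \<open>drop i xs @ take i xs\<close>, whose first block has length \<open>n - i\<close>.\<close>
  let ?i = "\<lambda>(i, \<tau>). drop (n - i) (code \<tau>) @ take (n - i) (code \<tau>)"
  have "sum_prob \<nu> n (n - 1) \<le> (\<Sum>(i, \<tau>)\<in>?B. weight \<nu> \<tau>)"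
    unfolding sum_prob_def
  proof (rule sum_le_included[where i = ?i], goal_cases)
    case 4
    show ?case
    proof
      fix xs assume "xs \<in> {xs. length xs = n \<and> sum_list xs = n - 1}"
      then obtain i \<tau> where \<tau>: "length xs = n" "i \<in> {1..n}" "code \<tau> = drop i xs @ take i xs"
        using code_cyclic_shift[of xs] assms by auto
      have "weight \<nu> \<tau> = ?p (drop i xs) * ?p (take i xs)"
        by (simp flip: prod_list_code add: \<tau>)
      also have "\<dots> = ?p (take i xs @ drop i xs)"
        by (simp del: append_take_drop_id add: mult.commute)
      finally have "weight \<nu> \<tau> = ?p xs" by simp
      moreover have "tsize \<tau> = n" using \<tau> length_code[of \<tau>] by simp
      ultimately show "\<exists>y\<in>?B. ?i y = xs \<and> ?p xs \<le> (case y of (i, \<tau>) \<Rightarrow> weight \<nu> \<tau>)"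
        using \<tau> by (intro bexI[of _ "(i, \<tau>)"]) auto
    qed
  qed (auto simp: finite_lists_length_sum)
  also have "\<dots> = n * (\<Sum>\<tau> | tsize \<tau> = n. weight \<nu> \<tau>)"
    by (simp flip: sum.cartesian_product)
  finally show ?thesis .
qed

lemma pmf_replicate_pmf:
  "pmf (replicate_pmf n \<nu>) xs = (if length xs = n then prod_list (map (pmf \<nu>) xs) else 0)"
proof (induction n arbitrary: xs)
  case (Suc n)
  have eq: "replicate_pmf (Suc n) \<nu> = map_pmf (\<lambda>(x, xs). x # xs) (pair_pmf \<nu> (replicate_pmf n \<nu>))"
    by (simp add: pair_pmf_def map_bind_pmf)
  show ?case
  proof (cases xs)
    case Nil
    then show ?thesis by (auto simp: pmf_eq_0_set_pmf set_replicate_pmf simp del: replicate_pmf.simps)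
  next
    case (Cons y ys)
    have "pmf (replicate_pmf (Suc n) \<nu>) ((\<lambda>(x, xs). x # xs) (y, ys))
      = pmf (pair_pmf \<nu> (replicate_pmf n \<nu>)) (y, ys)"
      unfolding eq by (rule pmf_map_inj') (auto simp: inj_def)
    then show ?thesis using Suc Cons by (simp add: pmf_pair del: replicate_pmf.simps)
  qed
qed (auto simp: indicator_def)

definition sum_pmf :: "nat pmf \<Rightarrow> nat \<Rightarrow> nat pmf" where
  "sum_pmf \<nu> n = map_pmf sum_list (replicate_pmf n \<nu>)"

text \<open>Links the combinatorial sum with the law of a random variable, to which moment bounds
  apply.\<close>

lemma pmf_sum_pmf: "pmf (sum_pmf \<nu> n) c = sum_prob \<nu> n c"
proof -
  have "pmf (sum_pmf \<nu> n) c = measure (replicate_pmf n \<nu>) {xs. sum_list xs = c}"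
    by (simp add: sum_pmf_def pmf_map vimage_def)
  also have "\<dots> = measure (replicate_pmf n \<nu>) {xs. length xs = n \<and> sum_list xs = c}"
    by (intro measure_pmf.finite_measure_eq_AE)
       (auto intro!: AE_pmfI simp: set_replicate_pmf)
  also have "\<dots> = sum_prob \<nu> n c"
    by (simp add: measure_measure_pmf_finite finite_lists_length_sum sum_prob_def pmf_replicate_pmf)
  finally show ?thesis .
qed

lemma sum_pmf_0: "sum_pmf \<nu> 0 = return_pmf 0"
  by (simp add: sum_pmf_def)

lemma sum_pmf_Suc: "sum_pmf \<nu> (Suc n) = map_pmf (\<lambda>(a, b). a + b) (pair_pmf \<nu> (sum_pmf \<nu> n))"
  by (simp add: sum_pmf_def pair_pmf_def map_bind_pmf bind_map_pmf)

section \<open>Moments, support and local lower bounds for an offspring law of mean one\<close>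

context
  fixes \<nu> :: "nat pmf"
  assumes mean: "measure_pmf.expectation \<nu> real = 1"
    and var: "integrable (measure_pmf \<nu>) (\<lambda>i. (real i - 1)\<^sup>2)"
begin

lemma integrable_offspring: "integrable (measure_pmf \<nu>) real"
  using mean not_integrable_integral_eq by fastforce

text \<open>With nonnegative integrals the induction needs no integrability of the sum; that follows
  from the finite value.\<close>

lemma nn_integral_sum_pmf: "(\<integral>\<^sup>+x. ennreal (real x) \<partial>measure_pmf (sum_pmf \<nu> n)) = ennreal (real n)"
proof (induction n)
  case (Suc n)
  have "(\<integral>\<^sup>+x. ennreal (real x) \<partial>measure_pmf (sum_pmf \<nu> (Suc n)))
      = (\<integral>\<^sup>+a. \<integral>\<^sup>+b. ennreal (real a) + ennreal (real b) \<partial>sum_pmf \<nu> n \<partial>\<nu>)"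
    by (simp add: sum_pmf_Suc nn_integral_pair_pmf')
  also have "\<dots> = ennreal 1 + ennreal (real n)"
    using nn_integral_eq_integral[OF integrable_offspring] mean
    by (simp add: nn_integral_add Suc measure_pmf.emeasure_space_1)
  finally show ?case by (simp flip: ennreal_plus add: ennreal_1[symmetric] del: ennreal_1)
qed (simp add: sum_pmf_0)

lemma integrable_sum_pmf: "integrable (measure_pmf (sum_pmf \<nu> n)) real"
  by (rule integrableI_nonneg) (auto simp: nn_integral_sum_pmf)

lemma expectation_sum_pmf: "measure_pmf.expectation (sum_pmf \<nu> n) real = real n"
  using nn_integral_eq_integral[OF integrable_sum_pmf] nn_integral_sum_pmf by simp

lemma nn_integral_sum_pmf_square:
  "(\<integral>\<^sup>+x. ennreal ((real x - real n)\<^sup>2) \<partial>measure_pmf (sum_pmf \<nu> n))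
     = ennreal (real n * measure_pmf.expectation \<nu> (\<lambda>i. (real i - 1)\<^sup>2))"
proof (induction n)
  case (Suc n)
  let ?V = "measure_pmf.expectation \<nu> (\<lambda>i. (real i - 1)\<^sup>2)"
  let ?S = "measure_pmf (sum_pmf \<nu> n)"
  have int: "integrable ?S (\<lambda>x. (real x - real n)\<^sup>2)"
    by (rule integrableI_nonneg) (auto simp: Suc)
  have V: "0 \<le> ?V" by (rule Bochner_Integration.integral_nonneg) simp
  have E: "(\<integral>x. (real x - real n)\<^sup>2 \<partial>?S) = real n * ?V"
    using nn_integral_eq_integral[OF int] Suc V by simp
  have inner: "(\<integral>\<^sup>+b. ennreal ((real (a + b) - real (Suc n))\<^sup>2) \<partial>?S)
      = ennreal ((real a - 1)\<^sup>2) + ennreal (real n * ?V)" for a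
  proof -
    \<comment> \<open>The cross term is linear in the centred variable
      \<open>real b - real n\<close> and integrates to \<open>0\<close>.\<close>
    have eq: "(real (a + b) - real (Suc n))\<^sup>2
        = (real a - 1)\<^sup>2 + 2 * (real a - 1) * (real b - real n) + (real b - real n)\<^sup>2" for b
      by (simp add: power2_eq_square algebra_simps)
    have int': "integrable ?S (\<lambda>b. (real (a + b) - real (Suc n))\<^sup>2)"
      unfolding eq using int integrable_sum_pmf by (intro Bochner_Integration.integrable_add integrable_mult_right) auto
    have "(\<integral>b. (real (a + b) - real (Suc n))\<^sup>2 \<partial>?S) = (real a - 1)\<^sup>2 + real n * ?V"
      unfolding eq using int integrable_sum_pmf[of n] expectation_sum_pmf[of n] E by simp
    then show ?thesis
      using nn_integral_eq_integral[OF int'] V by (simp add: ennreal_plus)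
  qed
  have "(\<integral>\<^sup>+x. ennreal ((real x - real (Suc n))\<^sup>2) \<partial>measure_pmf (sum_pmf \<nu> (Suc n)))
      = (\<integral>\<^sup>+a. ennreal ((real a - 1)\<^sup>2) + ennreal (real n * ?V) \<partial>\<nu>)"
    by (simp add: sum_pmf_Suc nn_integral_pair_pmf' inner[simplified])
  also have "\<dots> = ennreal ?V + ennreal (real n * ?V)"
    using nn_integral_eq_integral[OF var]
    by (simp add: nn_integral_add measure_pmf.emeasure_space_1)
  also have "\<dots> = ennreal (real (Suc n) * ?V)"
    using V by (simp flip: ennreal_plus add: algebra_simps)
  finally show ?case .
qed (simp add: sum_pmf_0)

lemma chebyshev_sum_pmf:
  assumes "0 < a"
  shows "measure (sum_pmf \<nu> n) {x. a \<le> \<bar>real x - real n\<bar>}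
    \<le> real n * measure_pmf.expectation \<nu> (\<lambda>i. (real i - 1)\<^sup>2) / a\<^sup>2"
proof -
  let ?V = "measure_pmf.expectation \<nu> (\<lambda>i. (real i - 1)\<^sup>2)"
  let ?S = "measure_pmf (sum_pmf \<nu> n)"
  have V: "0 \<le> ?V" by (rule Bochner_Integration.integral_nonneg) simp
  have int: "integrable ?S (\<lambda>x. (real x - real n)\<^sup>2)"
    by (rule integrableI_nonneg) (auto simp: nn_integral_sum_pmf_square)
  have E: "(\<integral>x. (real x - real n)\<^sup>2 \<partial>?S) = real n * ?V"
    using nn_integral_eq_integral[OF int] nn_integral_sum_pmf_square[of n] V by simp
  have "(\<lambda>x. (real x)\<^sup>2) = (\<lambda>x. (real x - real n)\<^sup>2 + 2 * real n * (real x - real n) + (real n)\<^sup>2)"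
    by (auto simp: power2_eq_square algebra_simps)
  then have "integrable ?S (\<lambda>x. (real x)\<^sup>2)"
    using int integrable_sum_pmf by (simp only:) (intro Bochner_Integration.integrable_add integrable_mult_right, auto)
  then show ?thesis
    using measure_pmf.Chebyshev_inequality[of real "sum_pmf \<nu> n" a] assms
    by (simp add: expectation_sum_pmf E)
qed

text \<open>By Chebyshev's inequality the window of radius \<open>\<eta> * m\<close> around
  \<open>m\<close> carries mass at least \<open>1 / 2\<close>. It contains at most
  \<open>2 * m + 1\<close> integers, so one of them has at least the average mass.\<close>

lemma sum_prob_near_mean:
  assumes "0 < \<eta>" "\<eta> \<le> (1::real)"
  shows "\<forall>\<^sub>F m in sequentially. \<exists>a. \<bar>real a - real m\<bar> < \<eta> * m \<and> 1 / (2 * (2 * real m + 1)) \<le> sum_prob \<nu> m a"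
proof -
  let ?V = "measure_pmf.expectation \<nu> (\<lambda>i. (real i - 1)\<^sup>2)"
  \<comment> \<open>The second condition brings Chebyshev's bound
    \<open>?V / (\<eta>\<^sup>2 * m)\<close> down to \<open>1 / 2\<close>.\<close>
  have "\<forall>\<^sub>F m in sequentially. 0 < m \<and> 2 * ?V / \<eta>\<^sup>2 \<le> real m"
    by (intro eventually_conj eventually_gt_at_top
        eventually_compose_filterlim[OF eventually_ge_at_top filterlim_real_sequentially])
  then show ?thesis
  proof eventually_elim
    case (elim m)
    let ?A = "{a. \<bar>real a - real m\<bar> < \<eta> * m}"
    have "\<eta> * m \<le> m" using assms by (simp add: mult_left_le_one_le)
    then have sub: "?A \<subseteq> {..2 * m}" by auto
    then have fin: "finite ?A" by (rule finite_subset) simp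
    have "card ?A \<le> 2 * m + 1" using card_mono[OF _ sub] by simp
    then have card: "real (card ?A) \<le> 2 * real m + 1" by linarith
    have "measure (sum_pmf \<nu> m) {x. \<eta> * m \<le> \<bar>real x - real m\<bar>} \<le> real m * ?V / (\<eta> * m)\<^sup>2"
      using assms elim by (intro chebyshev_sum_pmf) simp
    also have "\<dots> \<le> 1 / 2"
      using assms elim by (simp add: field_simps power2_eq_square)
    finally have "1 / 2 \<le> measure (sum_pmf \<nu> m) (UNIV - {x. \<eta> * m \<le> \<bar>real x - real m\<bar>})"
      using measure_pmf.prob_compl[of "{x. \<eta> * m \<le> \<bar>real x - real m\<bar>}" "sum_pmf \<nu> m"] by simp
    also have "UNIV - {x. \<eta> * m \<le> \<bar>real x - real m\<bar>} = ?A" by auto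
    also have "measure (sum_pmf \<nu> m) ?A = (\<Sum>a\<in>?A. sum_prob \<nu> m a)"
      by (simp add: measure_measure_pmf_finite fin pmf_sum_pmf)
    finally have half: "1 / 2 \<le> (\<Sum>a\<in>?A. sum_prob \<nu> m a)" .
    then have "?A \<noteq> {}" by (auto simp del: Collect_empty_eq)
    show ?case
    proof (rule ccontr)
      assume "\<not> ?case"
      then have "(\<Sum>a\<in>?A. sum_prob \<nu> m a) < (\<Sum>a\<in>?A. 1 / (2 * (2 * real m + 1)))"
        using fin \<open>?A \<noteq> {}\<close> by (intro sum_strict_mono) (auto simp: not_le)
      also have "\<dots> = real (card ?A) * (1 / (2 * (2 * real m + 1)))" by simp
      also have "\<dots> \<le> (2 * real m + 1) * (1 / (2 * (2 * real m + 1)))"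
        using card by (intro mult_right_mono) auto
      also have "\<dots> = 1 / 2" by (simp add: field_simps)
      finally show False using half by simp
    qed
  qed
qed

text \<open>A variable of mean \<open>0\<close> with constant sign vanishes almost surely. The sign
  of \<open>s\<close> selects the side of \<open>1\<close> on which \<open>\<nu>\<close> is
  supported.\<close>

lemma eq_return_pmf_1I:
  assumes "\<And>i. i \<in> set_pmf \<nu> \<Longrightarrow> 0 \<le> s * (1 - real i)" "s \<noteq> 0"
  shows "\<nu> = return_pmf 1"
proof -
  have "integrable \<nu> (\<lambda>i. s * (1 - real i))" and "(\<integral>i. s * (1 - real i) \<partial>\<nu>) = 0"
    using integrable_offspring mean by simp_all
  moreover have "AE i in \<nu>. 0 \<le> s * (1 - real i)"
    using assms by (intro AE_pmfI)
  ultimately have "AE i in \<nu>. s * (1 - real i) = 0"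
    using integral_nonneg_eq_0_iff_AE by blast
  then have "set_pmf \<nu> \<subseteq> {1}"
    using assms(2) by (auto simp: AE_measure_pmf_iff)
  then show ?thesis by (simp add: set_pmf_subset_singleton)
qed

lemma zero_in_support: "\<nu> \<noteq> return_pmf 1 \<Longrightarrow> 0 \<in> set_pmf \<nu>"
  using eq_return_pmf_1I[of "-1"] by (force simp: Suc_le_eq intro: gr0I)

lemma two_le_in_support: "\<nu> \<noteq> return_pmf 1 \<Longrightarrow> \<exists>b\<in>set_pmf \<nu>. 2 \<le> b"
  using eq_return_pmf_1I[of 1] by (force simp: not_le)

text \<open>Any sufficiently large number in an admissible residue class modulo \<open>b\<close> is written as one of
  finitely many fixed sums, plus copies of \<open>b\<close>, plus zeros.\<close>

lemma sum_prob_lower_bound: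
  assumes "\<nu> \<noteq> return_pmf 1"
  shows "\<exists>C b c. 0 < b \<and> 0 < c \<and> c \<le> 1 \<and> (\<forall>K r xs. set xs \<subseteq> set_pmf \<nu> \<longrightarrow> sum_list xs mod b = r mod b
      \<longrightarrow> C \<le> r \<longrightarrow> C + r \<le> 2 * K \<longrightarrow> c ^ K \<le> sum_prob \<nu> K r)"
proof -
  obtain b where b: "b \<in> set_pmf \<nu>" "2 \<le> b" using two_le_in_support[OF assms] by blast
  have zero: "0 \<in> set_pmf \<nu>" by (rule zero_in_support[OF assms])
  \<comment> \<open>One fixed list of support elements for each attained residue. At other residues
    the choice is arbitrary, which is why \<open>B\<close> intersects with the support.\<close>
  define L where "L k = (SOME xs. set xs \<subseteq> set_pmf \<nu> \<and> sum_list xs mod b = k)" for k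
  have L: "set (L k) \<subseteq> set_pmf \<nu> \<and> sum_list (L k) mod b = k"
    if "set xs \<subseteq> set_pmf \<nu>" "sum_list xs mod b = k" for k xs
    unfolding L_def by (rule someI[of _ xs]) (use that in simp)
  \<comment> \<open>\<open>C \<le> r\<close> makes the fixed list fit below \<open>r\<close>, and
    \<open>C + r \<le> 2 * K\<close> leaves room for it together with at most \<open>r / 2\<close>
    copies of \<open>b\<close>.\<close>
  define C where "C = Max ((\<lambda>k. 2 * length (L k) + sum_list (L k)) ` {..<b})"
  have C: "2 * length (L k) + sum_list (L k) \<le> C" if "k < b" for k
    unfolding C_def by (rule Max_ge) (use that in auto)
  define B where "B = insert 0 (insert b (\<Union>k<b. set (L k) \<inter> set_pmf \<nu>))"
  have B: "finite B" "B \<subseteq> set_pmf \<nu>" using b zero by (auto simp: B_def)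
  define c where "c = Min (pmf \<nu> ` B)"
  have "c \<in> pmf \<nu> ` B" unfolding c_def using B by (intro Min_in) (auto simp: B_def)
  then have c: "0 < c" "c \<le> 1" using B by (auto simp: pmf_positive pmf_le_1)
  have c_le: "c \<le> pmf \<nu> x" if "x \<in> B" for x
    unfolding c_def by (rule Min_le) (use that B in auto)
  have pow: "c ^ length ys \<le> prod_list (map (pmf \<nu>) ys)" if "set ys \<subseteq> B" for ys
    using that c c_le by (induction ys) (auto intro!: mult_mono prod_list_pmf_nonneg)
  have "c ^ K \<le> sum_prob \<nu> K r"
    if xs: "set xs \<subseteq> set_pmf \<nu>" "sum_list xs mod b = r mod b" and r: "C \<le> r" "C + r \<le> 2 * K" for K r xs
  proof -
    let ?l = "L (r mod b)"
    have kb: "r mod b < b" using b by simp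
    note l = L[OF xs]
    have le: "sum_list ?l \<le> r" using C[OF kb] r by linarith
    have "b dvd r - sum_list ?l"
      using mod_eq_dvd_iff_nat[OF le, of b] l by simp
    then obtain q where "r - sum_list ?l = b * q" by (elim dvdE)
    then have q: "r = sum_list ?l + b * q" using le by simp
    have "2 * q \<le> b * q" using b by simp
    then have len: "length ?l + q \<le> K" using C[OF kb] r q by linarith
    define ys where "ys = ?l @ replicate q b @ replicate (K - (length ?l + q)) 0"
    have "length ys = K" using len by (simp add: ys_def)
    moreover have "sum_list ys = r" by (subst q) (simp add: ys_def sum_list_replicate mult.commute)
    moreover have "set ys \<subseteq> B" using l kb by (auto simp: ys_def B_def set_replicate_conv_if)
    ultimately show ?thesis using pow[of ys] prod_list_le_sum_prob[of \<nu> ys] by simp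
  qed
  moreover have "0 < b" using b by simp
  ultimately show ?thesis using c by blast
qed

text \<open>The first \<open>m = n - K\<close> steps lead to a value \<open>a\<close> near
  \<open>m\<close> at polynomial cost, and the last \<open>K = n div J\<close> steps supply the
  missing \<open>r = n - 1 - a\<close> at cost \<open>c ^ K\<close>.\<close>

lemma sum_prob_subexponential:
  fixes \<delta> :: real
  assumes nontrivial: "\<nu> \<noteq> return_pmf 1" and \<delta>: "0 < \<delta>"
  shows "\<forall>\<^sub>F n in sequentially. 0 < sum_prob \<nu> n (n - 1) \<longrightarrow>
    exp (- \<delta> * n) * (1 / (2 * (2 * real n + 1))) \<le> sum_prob \<nu> n (n - 1)"
proof -
  obtain C b c where c: "0 < b" "0 < c" "c \<le> 1" and Cbc:
    "\<And>K r xs. set xs \<subseteq> set_pmf \<nu> \<Longrightarrow> sum_list xs mod b = r mod b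
      \<Longrightarrow> C \<le> r \<Longrightarrow> C + r \<le> 2 * K \<Longrightarrow> c ^ K \<le> sum_prob \<nu> K r"
    using sum_prob_lower_bound[OF nontrivial] by metis
  \<comment> \<open>A large \<open>J\<close> makes the correction phase so short that
    \<open>c ^ K \<ge> exp (- \<delta> * n)\<close>.\<close>
  obtain J :: nat where J0: "max 2 (- ln c / \<delta>) \<le> real J" using real_arch_simple by blast
  have J: "2 \<le> J" "- ln c \<le> \<delta> * J" using J0 \<delta> by (auto simp: field_simps)
  \<comment> \<open>The deviation of \<open>a\<close> from \<open>m\<close> is then at most about
    \<open>K / 2\<close>, which keeps \<open>r\<close> within the range where \<open>Cbc\<close>
    applies.\<close>
  define \<eta> where "\<eta> = 1 / (2 * real J)"
  have \<eta>: "0 < \<eta>" "\<eta> \<le> 1" using J by (auto simp: \<eta>_def)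
  have lim: "filterlim (\<lambda>n. n - n div J) at_top sequentially"
  proof (rule filterlim_at_top_mono)
    show "filterlim (\<lambda>n::nat. n div 2) at_top sequentially"
      by (rule filterlim_at_top_div_const_nat) simp
    have "n div 2 \<le> n - n div J" for n
    proof -
      have "n div J \<le> n div 2" using J by (intro div_le_mono2) auto
      then show ?thesis by linarith
    qed
    then show "\<forall>\<^sub>F n in sequentially. n div 2 \<le> n - n div J" by simp
  qed
  \<comment> \<open>Rounding gives \<open>K > n / J - 1\<close>; half of \<open>n / J\<close>
    absorbs the deviation and the other half exceeds \<open>C + 3\<close>.\<close>
  have "\<forall>\<^sub>F n in sequentially. 2 * J * (C + 3) \<le> n" by (rule eventually_ge_at_top)
  then show ?thesis
    using eventually_compose_filterlim[OF sum_prob_near_mean[OF \<eta>] lim]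
  proof eventually_elim
    case (elim n)
    define K where "K = n div J"
    define m where "m = n - K"
    obtain a where a: "\<bar>real a - real m\<bar> < \<eta> * m" "1 / (2 * (2 * real m + 1)) \<le> sum_prob \<nu> m a"
      using elim(2) unfolding m_def K_def by blast
    have Kn: "K \<le> n" "n = m + K" by (simp_all add: K_def m_def)
    have KJ: "K * J \<le> n" "n < K * J + J"
      using J by (simp_all add: K_def) (metis add.commute dividend_less_div_times less_le_trans mult.commute zero_less_numeral)
    have KJ': "real K * J \<le> n" "real n < real K * J + J"
      using KJ by (simp_all flip: of_nat_mult of_nat_add)
    have \<eta>m: "\<eta> * m \<le> n / (2 * J)" using J Kn by (simp add: \<eta>_def divide_right_mono)
    have "real n / J < K + 1" using KJ' J by (simp add: field_simps)
    moreover have "2 * (C + 3) \<le> real n / J"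
    proof -
      have "real (2 * J * (C + 3)) \<le> real n" using elim(1) by (simp only: of_nat_le_iff)
      then show ?thesis using J by (simp add: field_simps)
    qed
    ultimately have K_big: "n / (2 * J) + C + 2 < K" by (simp add: field_simps)
    have "real a < real m + real K - 1" using a(1) \<eta>m K_big by linarith
    then have a_le: "a \<le> n - 1" and n0: "0 < n" using Kn by linarith+
    define r where "r = n - 1 - a"
    have r: "real r = real K - 1 + (real m - real a)"
    proof -
      have "m + K = a + 1 + r" using a_le n0 unfolding r_def Kn(2) by linarith
      then have "real (m + K) = real (a + 1 + r)" by (rule arg_cong)
      then show ?thesis by simp
    qed
    show ?case
    proof
      assume "0 < sum_prob \<nu> n (n - 1)"
      then obtain ys where ys: "sum_list ys = n - 1" "set ys \<subseteq> set_pmf \<nu>"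
        by (auto simp: sum_prob_pos_iff)
      have "0 < 1 / (2 * (2 * real m + 1))" by simp
      then have "0 < sum_prob \<nu> m a" using a(2) by linarith
      then obtain xs where xs: "sum_list xs = a" "set xs \<subseteq> set_pmf \<nu>"
        by (auto simp: sum_prob_pos_iff)
      \<comment> \<open>Modulo \<open>b\<close>, subtracting \<open>a\<close> amounts to adding
        \<open>(b - 1) * a\<close>. Thus sums of support elements reach the residue class of
        \<open>r\<close>.\<close>
      define zs where "zs = ys @ concat (replicate (b - 1) xs)"
      have zs: "set zs \<subseteq> set_pmf \<nu>" using xs ys by (auto simp: zs_def)
      have "sum_list (concat (replicate i xs)) = i * a" for i
        using xs by (induction i) auto
      then have "sum_list zs = r + a + (b - 1) * a"
        using ys a_le by (simp add: zs_def r_def)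
      also have "\<dots> = r + b * a"
        using c(1) by (cases b) (auto simp: algebra_simps)
      finally have sum_zs: "sum_list zs = r + b * a" .
      have "c ^ K \<le> sum_prob \<nu> K r"
      proof (rule Cbc[OF zs])
        show "sum_list zs mod b = r mod b"
          by (simp add: sum_zs)
        have "real C \<le> real r" using r a(1) \<eta>m K_big by linarith
        then show "C \<le> r" by simp
        have "real C + real r \<le> 2 * real K" using r a(1) \<eta>m K_big by linarith
        then show "C + r \<le> 2 * K" by linarith
      qed
      have "exp (- \<delta> * n) \<le> c ^ K"
      proof -
        have "- ln c * K \<le> \<delta> * J * K" using J by (intro mult_right_mono) auto
        also have "\<dots> \<le> \<delta> * n" using KJ' \<delta> by (simp add: mult.assoc mult.commute[of "real J"])
        finally have "exp (- \<delta> * n) \<le> exp (real K * ln c)" by (simp add: mult.commute)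
        then show ?thesis using c by (simp add: exp_of_nat_mult)
      qed
      moreover have "1 / (2 * (2 * real n + 1)) \<le> 1 / (2 * (2 * real m + 1))"
        using Kn by (intro divide_left_mono) auto
      ultimately have "exp (- \<delta> * n) * (1 / (2 * (2 * real n + 1))) \<le> c ^ K * sum_prob \<nu> m a"
        using a(2) c by (intro mult_mono) auto
      also have "\<dots> \<le> sum_prob \<nu> K r * sum_prob \<nu> m a"
        using \<open>c ^ K \<le> sum_prob \<nu> K r\<close> \<open>0 < sum_prob \<nu> m a\<close> by (intro mult_right_mono) auto
      also have "\<dots> \<le> sum_prob \<nu> (K + m) (r + a)" by (rule sum_prob_add)
      also have "r + a = n - 1" using a_le by (simp add: r_def)
      also have "K + m = n" using Kn by simp
      finally show "exp (- \<delta> * n) * (1 / (2 * (2 * real n + 1))) \<le> sum_prob \<nu> n (n - 1)" .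
    qed
  qed
qed

text \<open>The cycle lemma transfers the bound from sums to tree sizes; half of
  \<open>\<delta>\<close> absorbs the polynomial factors. The code of a tree of positive weight
  shows that \<open>sum_prob\<close> is positive too.\<close>

lemma sum_weight_subexponential:
  fixes \<delta> :: real
  assumes nontrivial: "\<nu> \<noteq> return_pmf 1" and \<delta>: "0 < \<delta>"
  shows "\<forall>\<^sub>F n in sequentially. 0 < (\<Sum>\<tau> | tsize \<tau> = n. weight \<nu> \<tau>) \<longrightarrow>
    exp (- \<delta> * n) \<le> (\<Sum>\<tau> | tsize \<tau> = n. weight \<nu> \<tau>)"
proof -
  have "\<forall>\<^sub>F n in sequentially. real n * (2 * (2 * real n + 1)) \<le> exp (\<delta> / 2 * n)"
    using \<delta> by real_asymp
  moreover have "\<forall>\<^sub>F n in sequentially. 0 < sum_prob \<nu> n (n - 1) \<longrightarrow>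
      exp (- (\<delta> / 2) * n) * (1 / (2 * (2 * real n + 1))) \<le> sum_prob \<nu> n (n - 1)"
    using \<delta> by (intro sum_prob_subexponential[OF nontrivial]) simp
  ultimately show ?thesis
    using eventually_gt_at_top[of 0]
  proof eventually_elim
    case (elim n)
    let ?q = "\<Sum>\<tau> | tsize \<tau> = n. weight \<nu> \<tau>"
    show ?case
    proof
      assume "0 < ?q"
      then obtain \<tau> where \<tau>: "tsize \<tau> = n" "weight \<nu> \<tau> \<noteq> 0"
        by (metis (mono_tags, lifting) less_irrefl mem_Collect_eq sum.neutral)
      then have "0 < prod_list (map (pmf \<nu>) (code \<tau>))"
        using weight_nonneg[of \<nu> \<tau>] by (simp add: prod_list_code del: weight_nonneg)
      also have "\<dots> \<le> sum_prob \<nu> n (n - 1)"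
        using prod_list_le_sum_prob[of \<nu> "code \<tau>"] sum_list_code[of \<tau>] \<tau>
        by (metis diff_Suc_1 length_code)
      finally have "exp (- (\<delta> / 2) * n) * (1 / (2 * (2 * real n + 1))) \<le> sum_prob \<nu> n (n - 1)"
        using elim(2) by blast
      also have "\<dots> \<le> n * ?q" using elim(3) by (rule sum_prob_le_sum_weight)
      finally have "exp (- (\<delta> / 2) * n) \<le> (real n * (2 * (2 * real n + 1))) * ?q"
        by (simp add: field_simps)
      also have "\<dots> \<le> exp (\<delta> / 2 * n) * ?q"
        using elim(1) \<open>0 < ?q\<close> by (intro mult_right_mono) auto
      finally have "exp (- (\<delta> / 2) * n) / exp (\<delta> / 2 * n) \<le> ?q"
        by (simp add: field_simps)
      then show "exp (- \<delta> * n) \<le> ?q"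
        by (simp flip: exp_diff)
    qed
  qed
qed

end

section \<open>The sin-tree\<close>

lemma
  fixes M :: "'i \<Rightarrow> 'a pmf"
  assumes "finite J"
  shows sets_PiM_pmf_cylinder:
      "{\<omega>. \<forall>i\<in>J. \<omega> i \<in> A i} \<in> sets (\<Pi>\<^sub>M i\<in>UNIV. measure_pmf (M i))" (is ?sets)
    and measure_PiM_pmf_cylinder:
      "measure (\<Pi>\<^sub>M i\<in>UNIV. measure_pmf (M i)) {\<omega>. \<forall>i\<in>J. \<omega> i \<in> A i}
        = (\<Prod>i\<in>J. measure (M i) (A i))" (is ?measure)
proof -
  interpret product_prob_space "\<lambda>i. measure_pmf (M i)" UNIV
    by unfold_locales
  have eq: "{\<omega>. \<forall>i\<in>J. \<omega> i \<in> A i} = prod_emb UNIV (\<lambda>i. measure_pmf (M i)) J (Pi\<^sub>E J A)"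
    by (auto simp: prod_emb_def PiE_def Pi_def restrict_def extensional_def)
  show ?sets unfolding eq using assms by (intro sets_PiM_I) auto
  show ?measure unfolding eq using assms by (intro measure_PiM_emb) auto
qed

lemma prob_space_PiM_pmf: "prob_space (\<Pi>\<^sub>M i\<in>UNIV. measure_pmf (M i))"
  by (intro prob_space_PiM measure_pmf.prob_space_axioms)

lemma space_PiM_pmf: "space (\<Pi>\<^sub>M i\<in>UNIV. measure_pmf (M i)) = UNIV"
  by (simp add: space_PiM)

lemma
  shows sets_verts_GW_tree: "{\<omega>. verts (GW_tree \<omega>) = words \<tau>} \<in> sets (GW_space \<nu>)"
    and measure_verts_GW_tree: "measure (GW_space \<nu>) {\<omega>. verts (GW_tree \<omega>) = words \<tau>} = weight \<nu> \<tau>"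
  using sets_PiM_pmf_cylinder[OF finite_words, of \<tau> "\<lambda>u. {deg \<tau> u}" "\<lambda>_. \<nu>"]
    measure_PiM_pmf_cylinder[OF finite_words, of "\<lambda>_. \<nu>" \<tau> "\<lambda>u. {deg \<tau> u}"]
  by (simp_all add: verts_GW_tree_eq_words GW_space_def weight_def measure_pmf_single)

lemma prob_space_sin_space: "prob_space (sin_space \<nu>)"
  unfolding sin_space_def by (intro prob_space_pair prob_space_PiM_pmf)

lemma space_sin_space: "space (sin_space \<nu>) = UNIV"
  by (simp add: sin_space_def space_pair_measure space_PiM_pmf)

lemma measure_sin_space_cylinder:
  assumes "finite J" "finite X"
  shows "measure (sin_space \<nu>) {\<xi>. (\<forall>j\<in>J. fst \<xi> j \<in> A j) \<and> (\<forall>x\<in>X. snd \<xi> x \<in> B x)}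
    = (\<Prod>j\<in>J. measure (spine_order \<nu> j) (A j)) * (\<Prod>x\<in>X. measure (measure_pmf \<nu>) (B x))"
proof -
  interpret P1: prob_space "\<Pi>\<^sub>M j\<in>UNIV. measure_pmf (spine_order \<nu> j)" by (rule prob_space_PiM_pmf)
  interpret P2: prob_space "\<Pi>\<^sub>M x\<in>(UNIV :: (nat \<times> nat list) set). measure_pmf \<nu>" by (rule prob_space_PiM_pmf)
  let ?A = "{a. \<forall>j\<in>J. a j \<in> A j}" and ?B = "{b. \<forall>x\<in>X. b x \<in> B x}"
  have eq: "{\<xi>. (\<forall>j\<in>J. fst \<xi> j \<in> A j) \<and> (\<forall>x\<in>X. snd \<xi> x \<in> B x)} = ?A \<times> ?B" by auto
  have "measure (sin_space \<nu>) (?A \<times> ?B) =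
      measure (\<Pi>\<^sub>M j\<in>UNIV. measure_pmf (spine_order \<nu> j)) ?A * measure (\<Pi>\<^sub>M x\<in>UNIV. measure_pmf \<nu>) ?B"
    unfolding sin_space_def Sigma_Algebra.measure_def
    by (subst P2.emeasure_pair_measure_Times) (auto intro: sets_PiM_pmf_cylinder assms simp: enn2real_mult)
  then show ?thesis unfolding eq using assms by (simp add: measure_PiM_pmf_cylinder)
qed

lemma measurable_sin_space [measurable]:
  "(\<lambda>\<xi>. fst \<xi> j) \<in> measurable (sin_space \<nu>) (count_space UNIV)"
  "(\<lambda>\<xi>. snd \<xi> x) \<in> measurable (sin_space \<nu>) (count_space UNIV)"
proof -
  have "(\<lambda>\<xi>. fst \<xi> j) \<in> measurable (sin_space \<nu>) (measure_pmf (spine_order \<nu> j))"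
    unfolding sin_space_def
    by (rule measurable_compose[OF measurable_fst measurable_component_singleton]) simp
  then show "(\<lambda>\<xi>. fst \<xi> j) \<in> measurable (sin_space \<nu>) (count_space UNIV)"
    by (simp cong: measurable_cong_sets)
  have "(\<lambda>\<xi>. snd \<xi> x) \<in> measurable (sin_space \<nu>) (measure_pmf \<nu>)"
    unfolding sin_space_def
    by (rule measurable_compose[OF measurable_snd measurable_component_singleton]) simp
  then show "(\<lambda>\<xi>. snd \<xi> x) \<in> measurable (sin_space \<nu>) (count_space UNIV)"
    by (simp cong: measurable_cong_sets)
qed

lemma sets_sin_space_fst: "{\<xi>. P (fst \<xi> j)} \<in> sets (sin_space \<nu>)"
  using measurable_sets[OF measurable_sin_space(1), of "Collect P" j \<nu>]
  by (simp add: vimage_def space_sin_space)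

lemma sets_sin_space_snd: "{\<xi>. P (snd \<xi> x)} \<in> sets (sin_space \<nu>)"
  using measurable_sets[OF measurable_sin_space(2), of "Collect P" x \<nu>]
  by (simp add: vimage_def space_sin_space)

section \<open>The shape of the sin-tree below a vertex, and its measurability\<close>

lemma sin_children_spine:
  "sin_children \<xi> (j, []) = map (\<lambda>i. if 0 < j \<and> i = 0 then (j - 1, []) else (j, [i])) (fst \<xi> j)"
  by (cases \<xi>) (simp add: sin_children_def)

lemma sin_children_graft:
  "v \<noteq> [] \<Longrightarrow> sin_children \<xi> (j, v) = map (\<lambda>i. (j, v @ [i])) [0..<snd \<xi> (j, v)]"
  by (cases \<xi>) (simp add: sin_children_def)

lemma sets_sin_children: "{\<xi>. sin_children \<xi> y = c} \<in> sets (sin_space \<nu>)"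
proof (cases y)
  case (Pair j v)
  show ?thesis
  proof (cases "v = []")
    case True
    then show ?thesis
      using sets_sin_space_fst[of "\<lambda>l. map (\<lambda>i. if 0 < j \<and> i = 0 then (j - 1, []) else (j, [i])) l = c"]
      by (simp only: Pair sin_children_spine)
  next
    case False
    then show ?thesis
      using sets_sin_space_snd[of "\<lambda>m. map (\<lambda>i. (j, v @ [i])) [0..<m] = c"]
      by (simp only: Pair sin_children_graft[OF False])
  qed
qed

text \<open>Peels off one generation in an arbitrary plane tree, so that events about shapes can be
  treated by induction on the finite tree.\<close>

lemma Top_eq_words_Node:
  "Top s y = words (Node ts) \<longleftrightarrow> length (children s y) = length ts \<and>
    (\<forall>i<length ts. Top s (children s y ! i) = words (ts ! i))"
  (is "?L \<longleftrightarrow> ?R")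
proof
  have mem: "i # u \<in> Top s y \<longleftrightarrow> i < length (children s y) \<and> u \<in> Top s (children s y ! i)" for i u
    by (simp add: Top_def)
  have Nil: "[] \<in> Top s x" for x by (simp add: Top_def)
  {
    assume L: ?L
    have eq: "i < length (children s y) \<and> u \<in> Top s (children s y ! i)
        \<longleftrightarrow> i < length ts \<and> u \<in> words (ts ! i)" for i u
      using mem[of i u] L Cons_in_words[of i u ts] by simp
    have less_iff: "i < length (children s y) \<longleftrightarrow> i < length ts" for i
      using eq[of i "[]"] Nil by simp
    have len: "length (children s y) = length ts"
      using less_iff[of "length ts"] less_iff[of "length (children s y)"] by simp
    moreover have "Top s (children s y ! i) = words (ts ! i)" if "i < length ts" for i
      using eq[of i] that len by (intro set_eqI) simp
    ultimately show ?R by blast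
  next
    assume R: ?R
    show ?L
    proof (rule set_eqI)
      fix u show "u \<in> Top s y \<longleftrightarrow> u \<in> words (Node ts)"
        using R by (cases u) (auto simp: mem Nil)
    qed
  }
qed

lemma children_sin_tree [simp]: "children (sin_tree \<xi>) = sin_children \<xi>"
  by (simp add: sin_tree_def)

text \<open>The list of children takes countably many values, and for a fixed list the induction
  hypothesis applies to each entry.\<close>

lemma sets_Top_sin_tree: "{\<xi>. Top (sin_tree \<xi>) y = words \<tau>} \<in> sets (sin_space \<nu>)"
proof (induction \<tau> arbitrary: y)
  case (Node ts)
  have "{\<xi> \<in> space (sin_space \<nu>). \<forall>i\<in>{..<length ts}. Top (sin_tree \<xi>) (c ! i) = words (ts ! i)}
      \<in> sets (sin_space \<nu>)" for c
    using Node by (intro sets.sets_Collect_finite_All) (simp_all add: space_sin_space)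
  then have "{\<xi>. sin_children \<xi> y = c} \<inter>
      {\<xi> \<in> space (sin_space \<nu>). \<forall>i\<in>{..<length ts}. Top (sin_tree \<xi>) (c ! i) = words (ts ! i)}
      \<in> sets (sin_space \<nu>)" for c
    by (intro sets.Int sets_sin_children)
  moreover have "{\<xi>. Top (sin_tree \<xi>) y = words (Node ts)}
      = (\<Union>c\<in>{c. length c = length ts}. {\<xi>. sin_children \<xi> y = c} \<inter>
          {\<xi> \<in> space (sin_space \<nu>). \<forall>i\<in>{..<length ts}. Top (sin_tree \<xi>) (c ! i) = words (ts ! i)})"
    by (auto simp: Top_eq_words_Node space_sin_space)
  ultimately show ?case
    by (simp only:) (rule sets.countable_UN', auto simp del: sets.Int)
qed

text \<open>Inside a grafted tree the construction is that of an ordinary Galton--Watson tree, so a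
  prescribed shape is again a cylinder event.\<close>

lemma Top_sin_tree_graft:
  assumes "v \<noteq> []"
  shows "Top (sin_tree \<xi>) (j, v) = words \<tau> \<longleftrightarrow> (\<forall>u\<in>words \<tau>. snd \<xi> (j, v @ u) = deg \<tau> u)"
  using assms
proof (induction \<tau> arbitrary: v)
  case (Node ts)
  have ch: "children (sin_tree \<xi>) (j, v) = map (\<lambda>i. (j, v @ [i])) [0..<snd \<xi> (j, v)]"
    using Node.prems by (simp add: sin_children_graft)
  have "Top (sin_tree \<xi>) (j, v @ [i]) = words (ts ! i)
      \<longleftrightarrow> (\<forall>u\<in>words (ts ! i). snd \<xi> (j, v @ i # u) = deg (ts ! i) u)" if "i < length ts" for i
    using Node.IH[of "ts ! i" "v @ [i]"] that by simp
  then show ?case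
    unfolding Top_eq_words_Node ch by (auto simp: words_Node)
qed

text \<open>The almost sure form of an order on the spine. Nonemptiness for \<open>0 < j\<close>
  ensures that the label \<open>0\<close>, the previous spine vertex, is present.\<close>

definition spine_ok :: "nat \<Rightarrow> nat list \<Rightarrow> bool" where
  "spine_ok j l \<longleftrightarrow> l \<in> permutations_of_set {..<length l} \<and> (0 < j \<longrightarrow> l \<noteq> [])"

text \<open>A list of length \<open>m\<close> arises only if the offspring number is
  \<open>m\<close>, so the mixture reduces to one term.\<close>

lemma pmf_spine_order:
  assumes mean: "measure_pmf.expectation \<nu> real = 1" and l: "l \<in> permutations_of_set {..<m}"
  shows "pmf (spine_order \<nu> j) l = (if j = 0 then 1 else real m) * pmf \<nu> m / fact m"
proof -
  let ?p = "if j = 0 then \<nu> else size_biased \<nu>"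
  have len: "length l = m" using length_finite_permutations_of_set[OF l] by simp
  have other: "m' = m" if "l \<in> permutations_of_set {..<m'}" for m'
    using that len length_finite_permutations_of_set[of l "{..<m'}"] by auto
  have "pmf (spine_order \<nu> j) l = (\<integral>m'. pmf (pmf_of_set (permutations_of_set {..<m'})) l \<partial>?p)"
    by (simp add: spine_order_def pmf_bind)
  also have "\<dots> = (\<Sum>m'\<in>{m}. pmf (pmf_of_set (permutations_of_set {..<m'})) l * pmf ?p m')"
    by (rule integral_measure_pmf_real) (auto simp: indicator_def dest: other split: if_splits)
  also have "\<dots> = pmf ?p m / fact m"
    using l by (simp add: card_permutations_of_set)
  also have "\<dots> = (if j = 0 then 1 else real m) * pmf \<nu> m / fact m"
    using pmf_size_biased[OF mean] by simp
  finally show ?thesis .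
qed

lemma spine_ok_spine_order:
  assumes mean: "measure_pmf.expectation \<nu> real = 1" and "l \<in> set_pmf (spine_order \<nu> j)"
  shows "spine_ok j l"
proof -
  obtain m where m: "m \<in> set_pmf (if j = 0 then \<nu> else size_biased \<nu>)" "l \<in> permutations_of_set {..<m}"
    using assms(2) by (auto simp: spine_order_def)
  then have "length l = m" using length_finite_permutations_of_set[OF m(2)] by simp
  moreover have "0 < m" if "0 < j"
    using m(1) that pmf_size_biased[OF mean, of m] by (auto simp: set_pmf_iff intro: gr0I)
  ultimately show ?thesis using m by (auto simp: spine_ok_def)
qed

lemma AE_spine_ok:
  assumes mean: "measure_pmf.expectation \<nu> real = 1"
  shows "AE \<xi> in sin_space \<nu>. \<forall>j. spine_ok j (fst \<xi> j)"
proof -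
  interpret prob_space "sin_space \<nu>" by (rule prob_space_sin_space)
  have "AE \<xi> in sin_space \<nu>. spine_ok j (fst \<xi> j)" for j
  proof -
    have "prob {\<xi>. fst \<xi> j \<in> set_pmf (spine_order \<nu> j)} = 1"
      using measure_sin_space_cylinder[of "{j}" "{}" \<nu> "\<lambda>j. set_pmf (spine_order \<nu> j)" "\<lambda>_. {}"]
      by (simp add: measure_pmf.prob_eq_1 AE_measure_pmf)
    then have "AE \<xi> in sin_space \<nu>. fst \<xi> j \<in> set_pmf (spine_order \<nu> j)"
      using AE_prob_1 by fastforce
    then show ?thesis
      by eventually_elim (rule spine_ok_spine_order[OF mean])
  qed
  then show ?thesis by (simp add: AE_all_countable)
qed

text \<open>The line of ancestors breaks where an order lacks the label \<open>0\<close>; by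
  \<open>AE_spine_ok\<close> this happens only on a null set.\<close>

lemma ancestor_sin_tree:
  "ancestor (sin_tree \<xi>) (0, []) k
    = (if \<forall>j\<in>{1..k}. 0 \<in> set (fst \<xi> j) then Some (k, []) else None)"
proof (induction k)
  case (Suc k)
  obtain ord \<omega> where \<xi>: "\<xi> = (ord, \<omega>)" by (cases \<xi>)
  have "parent (sin_tree \<xi>) (k, []) = (if 0 \<in> set (ord (Suc k)) then Some (Suc k, []) else None)"
  proof (cases "0 \<in> set (ord (Suc k))")
    case True
    then show ?thesis using parent_sin_tree[of ord k \<omega>] by (simp add: \<xi>)
  next
    case False
    have "(k, []) \<notin> set (children (sin_tree \<xi>) y)" for y
      using False by (cases y) (auto simp: \<xi> sin_tree_def sin_children_def split: if_splits)
    then show ?thesis using False by (auto simp: parent_def)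
  qed
  then show ?case using Suc by (auto simp: \<xi> atLeastAtMostSuc_conv)
qed simp

section \<open>Cylinder events and the law of the subtree at a spine vertex\<close>

definition cyl where
  "cyl J a X b = {\<xi> :: (nat \<Rightarrow> nat list) \<times> (nat \<times> nat list \<Rightarrow> nat).
     (\<forall>j\<in>J. fst \<xi> j = a j) \<and> (\<forall>x\<in>X. snd \<xi> x = b x)}"

lemma sets_cyl:
  assumes "finite J" "finite X"
  shows "cyl J a X b \<in> sets (sin_space \<nu>)"
proof -
  have "cyl J a X b = {\<xi> \<in> space (sin_space \<nu>). \<forall>j\<in>J. fst \<xi> j = a j} \<inter> {\<xi> \<in> space (sin_space \<nu>). \<forall>x\<in>X. snd \<xi> x = b x}"
    by (auto simp: cyl_def space_sin_space)
  also have "\<dots> \<in> sets (sin_space \<nu>)"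
    using assms sets_sin_space_fst[of "\<lambda>l. l = a _"] sets_sin_space_snd[of "\<lambda>m. m = b _"]
    by (intro sets.Int sets.sets_Collect_finite_All) (auto simp: space_sin_space)
  finally show ?thesis .
qed

lemma measure_cyl:
  assumes "finite J" "finite X"
  shows "measure (sin_space \<nu>) (cyl J a X b)
    = (\<Prod>j\<in>J. pmf (spine_order \<nu> j) (a j)) * (\<Prod>x\<in>X. pmf \<nu> (b x))"
  using measure_sin_space_cylinder[OF assms, of \<nu> "\<lambda>j. {a j}" "\<lambda>x. {b x}"]
  by (simp add: cyl_def measure_pmf_single)

text \<open>Prescribing the order at \<open>u_k\<close> and the trees at the positions in
  \<open>I\<close> fixes further coordinates only, so the result is a cylinder and the measures
  multiply. The bounds by \<open>k\<close> make these coordinates new, and the weaker bounds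
  obtained suit the next lower level.\<close>

lemma cyl_graft:
  assumes fin: "finite J" "finite X" and J: "\<forall>j\<in>J. k < j" and X: "\<forall>x\<in>X. k < fst x"
    and l: "l \<in> permutations_of_set {..<length ts}" and I: "I \<subseteq> {..<length ts}"
  obtains J' a' X' b' where "finite J'" "finite X'" "\<forall>j\<in>J'. k \<le> j" "\<forall>x\<in>X'. k \<le> fst x"
    and "cyl J' a' X' b' = cyl J a X b \<inter>
      {\<xi>. fst \<xi> k = l \<and> (\<forall>i\<in>I. \<forall>u\<in>words (ts ! i). snd \<xi> (k, l ! i # u) = deg (ts ! i) u)}"
    and "measure (sin_space \<nu>) (cyl J' a' X' b')
      = pmf (spine_order \<nu> k) l * (\<Prod>i\<in>I. weight \<nu> (ts ! i)) * measure (sin_space \<nu>) (cyl J a X b)"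
proof -
  let ?m = "length ts"
  have len: "length l = ?m" and dist: "distinct l"
    using l length_finite_permutations_of_set[OF l] by (auto simp: permutations_of_set_def)
  have inj: "inj_on ((!) l) {..<?m}" using dist len by (simp add: inj_on_nth)
  have nth_eq: "l ! i = l ! i' \<longleftrightarrow> i = i'" if "i \<in> I" "i' \<in> I" for i i'
  proof -
    have "i < length l" "i' < length l" using that I len by auto
    then show ?thesis by (rule nth_eq_iff_index_eq[OF dist])
  qed
  have finI: "finite I" using I finite_subset by blast
  define Y where "Y = (\<Union>i\<in>I. (\<lambda>u. (k, l ! i # u)) ` words (ts ! i))"
  \<comment> \<open>The first letter of a word is a label \<open>l ! i\<close>; inverting
    \<open>(!) l\<close> recovers the position \<open>i\<close>, and thereby the tree whose degrees
    are prescribed.\<close>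
  define b' where "b' = (\<lambda>(j, v). if j = k then deg (ts ! inv_into {..<?m} ((!) l) (hd v)) (tl v) else b (j, v))"
  have b': "b' (k, l ! i # u) = deg (ts ! i) u" if "i \<in> I" for i u
    using that I inv_into_f_f[OF inj, of i] by (auto simp: b'_def)
  have b'X: "b' x = b x" if "x \<in> X" for x
    using X that by (auto simp: b'_def split: prod.splits)
  have finY: "finite Y" using finI by (simp add: Y_def)
  have disj: "X \<inter> Y = {}" using X by (auto simp: Y_def)
  have kJ: "k \<notin> J" using J by auto
  show thesis
  proof (rule that[of "insert k J" "X \<union> Y" "a(k := l)" b'])
    show "cyl (insert k J) (a(k := l)) (X \<union> Y) b' = cyl J a X b \<inter>
      {\<xi>. fst \<xi> k = l \<and> (\<forall>i\<in>I. \<forall>u\<in>words (ts ! i). snd \<xi> (k, l ! i # u) = deg (ts ! i) u)}"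
    proof (rule set_eqI)
      fix \<xi> :: "(nat \<Rightarrow> nat list) \<times> (nat \<times> nat list \<Rightarrow> nat)"
      have "(\<forall>x\<in>Y. snd \<xi> x = b' x) \<longleftrightarrow> (\<forall>i\<in>I. \<forall>u\<in>words (ts ! i). snd \<xi> (k, l ! i # u) = deg (ts ! i) u)"
        by (simp add: Y_def b')
      moreover have "(\<forall>x\<in>X. snd \<xi> x = b' x) \<longleftrightarrow> (\<forall>x\<in>X. snd \<xi> x = b x)"
        by (simp add: b'X)
      moreover have "(\<forall>j\<in>J. fst \<xi> j = (a(k := l)) j) \<longleftrightarrow> (\<forall>j\<in>J. fst \<xi> j = a j)"
        using kJ by (intro ball_cong) auto
      ultimately show "\<xi> \<in> cyl (insert k J) (a(k := l)) (X \<union> Y) b' \<longleftrightarrow> \<xi> \<in> cyl J a X b \<inter>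
          {\<xi>. fst \<xi> k = l \<and> (\<forall>i\<in>I. \<forall>u\<in>words (ts ! i). snd \<xi> (k, l ! i # u) = deg (ts ! i) u)}"
        by (simp add: cyl_def ball_Un) blast
    qed
    have "(\<Prod>x\<in>Y. pmf \<nu> (b' x)) = (\<Prod>i\<in>I. \<Prod>x\<in>(\<lambda>u. (k, l ! i # u)) ` words (ts ! i). pmf \<nu> (b' x))"
      unfolding Y_def by (rule prod.UNION_disjoint) (auto simp: finI nth_eq)
    also have "\<dots> = (\<Prod>i\<in>I. weight \<nu> (ts ! i))"
      by (intro prod.cong refl) (simp add: prod.reindex inj_on_def b' weight_def)
    finally have Y: "(\<Prod>x\<in>Y. pmf \<nu> (b' x)) = (\<Prod>i\<in>I. weight \<nu> (ts ! i))" .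
    have "(\<Prod>j\<in>insert k J. pmf (spine_order \<nu> j) ((a(k := l)) j))
        = pmf (spine_order \<nu> k) l * (\<Prod>j\<in>J. pmf (spine_order \<nu> j) (a j))"
      using fin kJ by (auto intro!: prod.cong)
    moreover have "(\<Prod>x\<in>X \<union> Y. pmf \<nu> (b' x)) = (\<Prod>x\<in>X. pmf \<nu> (b x)) * (\<Prod>i\<in>I. weight \<nu> (ts ! i))"
      by (subst prod.union_disjoint) (auto simp: fin finY disj b'X Y)
    ultimately show "measure (sin_space \<nu>) (cyl (insert k J) (a(k := l)) (X \<union> Y) b')
      = pmf (spine_order \<nu> k) l * (\<Prod>i\<in>I. weight \<nu> (ts ! i)) * measure (sin_space \<nu>) (cyl J a X b)"
      using fin finY by (simp add: measure_cyl)
  qed (use fin finY J X in \<open>auto simp: Y_def less_imp_le\<close>)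
qed

text \<open>Deleting the entry \<open>0\<close> at position \<open>i\<close> is a bijection onto the
  orderings of \<open>{1..<m}\<close>.\<close>

lemma card_permutations_of_set_nth:
  assumes "i < m"
  shows "card {l \<in> permutations_of_set {..<m}. l ! i = 0} = fact (m - 1)"
proof -
  let ?f = "\<lambda>l. take i l @ drop (Suc i) l" and ?g = "\<lambda>l. take i l @ 0 # drop i l"
  have len: "length l = m" if "l \<in> permutations_of_set {..<m}" for l
    using length_finite_permutations_of_set[OF that] by simp
  have len': "length l = m - 1" if "l \<in> permutations_of_set {1..<m}" for l
    using length_finite_permutations_of_set[OF that] by simp
  have "bij_betw ?f {l \<in> permutations_of_set {..<m}. l ! i = 0} (permutations_of_set {1..<m})"
  proof (rule bij_betw_byWitness[where f' = ?g])
    show "\<forall>l\<in>{l \<in> permutations_of_set {..<m}. l ! i = 0}. ?g (?f l) = l"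
      using assms by (auto simp: len min_def) (metis id_take_nth_drop len)
    show "\<forall>l\<in>permutations_of_set {1..<m}. ?f (?g l) = l"
      using assms by (auto simp: len' min_def)
    show "?f ` {l \<in> permutations_of_set {..<m}. l ! i = 0} \<subseteq> permutations_of_set {1..<m}"
    proof (rule image_subsetI)
      fix l assume l: "l \<in> {l \<in> permutations_of_set {..<m}. l ! i = 0}"
      then have "l = take i l @ 0 # drop (Suc i) l"
        using assms by (metis (mono_tags, lifting) id_take_nth_drop len mem_Collect_eq)
      moreover have "distinct l" "set l = {..<m}" using l by (auto simp: permutations_of_set_def)
      ultimately have "distinct (take i l @ 0 # drop (Suc i) l)" "set (take i l @ 0 # drop (Suc i) l) = {..<m}"
        by simp_all
      then have "distinct (?f l)" and "0 \<notin> set (?f l)" and "insert 0 (set (?f l)) = {..<m}" by auto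
      then have "set (?f l) = {..<m} - {0}" "distinct (?f l)" by blast+
      moreover have "{..<m} - {0} = {1..<m}" by auto
      ultimately show "?f l \<in> permutations_of_set {1..<m}" by (simp add: permutations_of_set_def)
    qed
    show "?g ` permutations_of_set {1..<m} \<subseteq> {l \<in> permutations_of_set {..<m}. l ! i = 0}"
    proof (rule image_subsetI)
      fix l assume l: "l \<in> permutations_of_set {1..<m}"
      then have *: "distinct (take i l @ drop i l)" "set (take i l @ drop i l) = {1..<m}"
        by (simp_all add: permutations_of_set_def)
      moreover have "0 \<notin> set (take i l)" "0 \<notin> set (drop i l)"
        using l by (auto simp: permutations_of_set_def dest: in_set_takeD in_set_dropD)
      ultimately have "set (?g l) = insert 0 {1..<m}" "distinct (?g l)"
        by (auto simp del: append_take_drop_id)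
      moreover have "insert 0 {1..<m} = {..<m}" using assms by auto
      ultimately show "?g l \<in> {l \<in> permutations_of_set {..<m}. l ! i = 0}"
        using assms len'[OF l] by (auto simp: permutations_of_set_def nth_append)
    qed
  qed
  then show ?thesis by (simp add: bij_betw_same_card)
qed

text \<open>Requiring valid orders up to level \<open>k\<close> gives each of
  \<open>u_1, ..., u_k\<close> exactly one child on the spine, so the event splits into disjoint
  pieces.\<close>

definition spine_event where
  "spine_event k \<tau> = {\<xi>. Top (sin_tree \<xi>) (k, []) = words \<tau> \<and> (\<forall>j\<le>k. spine_ok j (fst \<xi> j))}"

lemma sets_spine_event: "spine_event k \<tau> \<in> sets (sin_space \<nu>)"
proof -
  have "spine_event k \<tau> = {\<xi>. Top (sin_tree \<xi>) (k, []) = words \<tau>} \<inter>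
      {\<xi> \<in> space (sin_space \<nu>). \<forall>j\<in>{..k}. spine_ok j (fst \<xi> j)}"
    by (auto simp: spine_event_def space_sin_space)
  also have "\<dots> \<in> sets (sin_space \<nu>)"
    using sets_sin_space_fst by (intro sets.Int sets_Top_sin_tree sets.sets_Collect_finite_All)
      (auto simp: space_sin_space)
  finally show ?thesis .
qed

lemma spine_event_0:
  "spine_event 0 (Node ts) = (\<Union>l\<in>permutations_of_set {..<length ts}.
    {\<xi>. fst \<xi> 0 = l \<and> (\<forall>i<length ts. \<forall>u\<in>words (ts ! i). snd \<xi> (0, l ! i # u) = deg (ts ! i) u)})"
proof -
  have len: "length l = length ts" if "l \<in> permutations_of_set {..<length ts}" for l
    using length_finite_permutations_of_set[OF that] by simp
  have "Top (sin_tree \<xi>) (0, []) = words (Node ts) \<longleftrightarrow> length (fst \<xi> 0) = length ts \<and>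
      (\<forall>i<length ts. \<forall>u\<in>words (ts ! i). snd \<xi> (0, fst \<xi> 0 ! i # u) = deg (ts ! i) u)" for \<xi>
    by (simp add: Top_eq_words_Node sin_children_spine Top_sin_tree_graft cong: conj_cong)
  then show ?thesis
    using len by (auto simp: spine_event_def spine_ok_def)
qed

text \<open>Here \<open>i\<close> is the position of the spine child and \<open>l\<close> the order
  at the new spine vertex. The spine child must carry \<open>ts ! i\<close>, and the other positions
  carry grafted trees.\<close>

lemma spine_event_Suc:
  "spine_event (Suc k) (Node ts) =
    (\<Union>(i, l)\<in>(SIGMA i:{..<length ts}. {l \<in> permutations_of_set {..<length ts}. l ! i = 0}).
      spine_event k (ts ! i) \<inter> {\<xi>. fst \<xi> (Suc k) = l \<and>
        (\<forall>i'\<in>{..<length ts} - {i}. \<forall>u\<in>words (ts ! i'). snd \<xi> (Suc k, l ! i' # u) = deg (ts ! i') u)})"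
  (is "_ = (\<Union>(i, l)\<in>?R. ?E i l)")
proof (rule set_eqI)
  fix \<xi> :: "(nat \<Rightarrow> nat list) \<times> (nat \<times> nat list \<Rightarrow> nat)"
  let ?l = "fst \<xi> (Suc k)"
  have len: "length l = length ts" if "l \<in> permutations_of_set {..<length ts}" for l
    using length_finite_permutations_of_set[OF that] by simp
  have ch: "length (sin_children \<xi> (Suc k, [])) = length ?l"
      "i < length ?l \<Longrightarrow> sin_children \<xi> (Suc k, []) ! i = (if ?l ! i = 0 then (k, []) else (Suc k, [?l ! i]))" for i
    by (simp_all add: sin_children_spine)
  have uniq: "?l ! i' = 0 \<longleftrightarrow> i' = i"
    if "?l \<in> permutations_of_set {..<length ts}" "i < length ts" "i' < length ts" "?l ! i = 0" for i i'
    using that nth_eq_iff_index_eq[of ?l i' i] len[OF that(1)] by (auto simp: permutations_of_set_def)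
  have Top: "Top (sin_tree \<xi>) (Suc k, []) = words (Node ts) \<longleftrightarrow>
      Top (sin_tree \<xi>) (k, []) = words (ts ! i) \<and>
      (\<forall>i'\<in>{..<length ts} - {i}. \<forall>u\<in>words (ts ! i'). snd \<xi> (Suc k, ?l ! i' # u) = deg (ts ! i') u)"
    if "?l \<in> permutations_of_set {..<length ts}" "i < length ts" "?l ! i = 0" for i
  proof -
    have "(Top (sin_tree \<xi>) (sin_children \<xi> (Suc k, []) ! i') = words (ts ! i')) \<longleftrightarrow>
        (if i' = i then Top (sin_tree \<xi>) (k, []) = words (ts ! i)
         else \<forall>u\<in>words (ts ! i'). snd \<xi> (Suc k, ?l ! i' # u) = deg (ts ! i') u)"
      if "i' < length ts" for i'
      using that uniq[OF \<open>?l \<in> _\<close> \<open>i < _\<close> that \<open>?l ! i = 0\<close>] len[OF \<open>?l \<in> _\<close>]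
      by (simp add: ch Top_sin_tree_graft)
    then have "Top (sin_tree \<xi>) (Suc k, []) = words (Node ts) \<longleftrightarrow> (\<forall>i'<length ts.
        if i' = i then Top (sin_tree \<xi>) (k, []) = words (ts ! i)
        else \<forall>u\<in>words (ts ! i'). snd \<xi> (Suc k, ?l ! i' # u) = deg (ts ! i') u)"
      using len[OF \<open>?l \<in> _\<close>] by (simp add: Top_eq_words_Node ch(1) cong: all_cong)
    also have "\<dots> \<longleftrightarrow> Top (sin_tree \<xi>) (k, []) = words (ts ! i) \<and>
      (\<forall>i'\<in>{..<length ts} - {i}. \<forall>u\<in>words (ts ! i'). snd \<xi> (Suc k, ?l ! i' # u) = deg (ts ! i') u)"
      using \<open>i < length ts\<close> by (auto split: if_splits simp del: set_eq_subset)
    finally show ?thesis .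
  qed
  show "\<xi> \<in> spine_event (Suc k) (Node ts) \<longleftrightarrow> \<xi> \<in> (\<Union>(i, l)\<in>?R. ?E i l)"
  proof
    assume \<xi>: "\<xi> \<in> spine_event (Suc k) (Node ts)"
    then have "length ?l = length ts" by (auto simp: spine_event_def Top_eq_words_Node ch)
    moreover have "spine_ok (Suc k) ?l" using \<xi> by (auto simp: spine_event_def)
    ultimately have l: "?l \<in> permutations_of_set {..<length ts}" and "ts \<noteq> []"
      by (auto simp: spine_ok_def)
    then have "0 \<in> set ?l" by (simp add: permutations_of_set_def)
    then obtain i where i: "i < length ts" "?l ! i = 0"
      using len[OF l] by (auto simp: in_set_conv_nth)
    then have "\<xi> \<in> ?E i ?l" using \<xi> Top[OF l i] by (simp add: spine_event_def)
    then show "\<xi> \<in> (\<Union>(i, l)\<in>?R. ?E i l)" using i l by blast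
  next
    assume "\<xi> \<in> (\<Union>(i, l)\<in>?R. ?E i l)"
    then obtain i l where il: "(i, l) \<in> ?R" and "\<xi> \<in> ?E i l" by blast
    moreover from this have "l = ?l" by simp
    ultimately have i: "i < length ts" "?l ! i = 0" and l: "?l \<in> permutations_of_set {..<length ts}"
      and \<xi>: "\<xi> \<in> ?E i ?l" by simp_all
    have "spine_ok (Suc k) ?l" using i l len[OF l] by (auto simp: spine_ok_def)
    moreover have "\<forall>j\<le>k. spine_ok j (fst \<xi> j)" using \<xi> by (simp add: spine_event_def)
    ultimately have "\<forall>j\<le>Suc k. spine_ok j (fst \<xi> j)" by (auto simp: le_Suc_eq)
    then show "\<xi> \<in> spine_event (Suc k) (Node ts)"
      using \<xi> Top[OF l i] by (simp add: spine_event_def)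
  qed
qed

text \<open>The cylinder in the statement makes the induction work without an appeal to independence.\<close>

lemma measure_spine_event_cyl:
  assumes mean: "measure_pmf.expectation \<nu> real = 1"
    and "finite J" "finite X" "\<forall>j\<in>J. k < j" "\<forall>x\<in>X. k < fst x"
  shows "measure (sin_space \<nu>) (spine_event k \<tau> \<inter> cyl J a X b)
    = level_card k \<tau> * weight \<nu> \<tau> * measure (sin_space \<nu>) (cyl J a X b)"
  using assms(2-)
proof (induction k arbitrary: \<tau> J a X b)
  case 0
  interpret prob_space "sin_space \<nu>" by (rule prob_space_sin_space)
  obtain ts where \<tau>: "\<tau> = Node ts" by (cases \<tau>)
  let ?m = "length ts" and ?P = "permutations_of_set {..<length ts}"
  define E where "E l = cyl J a X b \<inter> {\<xi>. fst \<xi> 0 = l \<and>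
      (\<forall>i\<in>{..<?m}. \<forall>u\<in>words (ts ! i). snd \<xi> (0, l ! i # u) = deg (ts ! i) u)}" for l
  have E: "E l \<in> events \<and> prob (E l) = pmf \<nu> ?m / fact ?m * (\<Prod>i<?m. weight \<nu> (ts ! i)) * prob (cyl J a X b)"
    if l: "l \<in> ?P" for l
  proof -
    obtain J' a' X' b' where fin: "finite J'" "finite X'" and C: "cyl J' a' X' b' = cyl J a X b \<inter> {\<xi>. fst \<xi> 0 = l \<and>
        (\<forall>i\<in>{..<?m}. \<forall>u\<in>words (ts ! i). snd \<xi> (0, l ! i # u) = deg (ts ! i) u)}"
      and pC: "prob (cyl J' a' X' b')
        = pmf (spine_order \<nu> 0) l * (\<Prod>i<?m. weight \<nu> (ts ! i)) * prob (cyl J a X b)"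
      by (rule cyl_graft[OF 0 l order_refl, of a b \<nu>]) (rule that; assumption)
    show ?thesis
      using sets_cyl[OF fin, of a' b' \<nu>] pC pmf_spine_order[OF mean l, of 0] by (simp add: E_def C)
  qed
  have "spine_event 0 \<tau> \<inter> cyl J a X b = (\<Union>l\<in>?P. E l)"
    by (auto simp: \<tau> spine_event_0 E_def)
  also have "prob \<dots> = (\<Sum>l\<in>?P. prob (E l))"
    using E by (intro finite_measure_finite_Union) (auto simp: disjoint_family_on_def E_def)
  \<comment> \<open>The number \<open>fact ?m\<close> of orders cancels the uniform probability of
    each.\<close>
  also have "\<dots> = weight \<nu> \<tau> * prob (cyl J a X b)"
    using E by (simp add: \<tau> weight_Node_nth)
  finally show ?case by simp
next
  case (Suc k)
  interpret prob_space "sin_space \<nu>" by (rule prob_space_sin_space)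
  obtain ts where \<tau>: "\<tau> = Node ts" by (cases \<tau>)
  let ?m = "length ts" and ?P = "permutations_of_set {..<length ts}"
  let ?R = "SIGMA i:{..<?m}. {l \<in> ?P. l ! i = 0}"
  let ?C = "prob (cyl J a X b)"
  define E where "E = (\<lambda>(i, l). spine_event k (ts ! i) \<inter> (cyl J a X b \<inter> {\<xi>. fst \<xi> (Suc k) = l \<and>
      (\<forall>i'\<in>{..<?m} - {i}. \<forall>u\<in>words (ts ! i'). snd \<xi> (Suc k, l ! i' # u) = deg (ts ! i') u)}))"
  have E: "E (i, l) \<in> events \<and> prob (E (i, l))
      = level_card k (ts ! i) * (real ?m / fact ?m * weight \<nu> \<tau> * ?C)"
    if i: "i < ?m" and l: "l \<in> ?P" for i l
  proof -
    obtain J' a' X' b' where fin: "finite J'" "finite X'" and ge: "\<forall>j\<in>J'. Suc k \<le> j" "\<forall>x\<in>X'. Suc k \<le> fst x"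
      and C: "cyl J' a' X' b' = cyl J a X b \<inter> {\<xi>. fst \<xi> (Suc k) = l \<and>
        (\<forall>i'\<in>{..<?m} - {i}. \<forall>u\<in>words (ts ! i'). snd \<xi> (Suc k, l ! i' # u) = deg (ts ! i') u)}"
      and pC: "prob (cyl J' a' X' b') = pmf (spine_order \<nu> (Suc k)) l * (\<Prod>i'\<in>{..<?m} - {i}. weight \<nu> (ts ! i')) * ?C"
      by (rule cyl_graft[OF Suc.prems l Diff_subset[of _ "{i}"], of a b \<nu>]) (rule that; assumption)
    have Ei: "E (i, l) = spine_event k (ts ! i) \<inter> cyl J' a' X' b'" by (simp add: E_def C)
    have "prob (E (i, l)) = level_card k (ts ! i) * weight \<nu> (ts ! i) * prob (cyl J' a' X' b')"
      unfolding Ei using ge by (intro Suc.IH fin) (auto simp: Suc_le_eq)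
    also have "\<dots> = level_card k (ts ! i) * (pmf (spine_order \<nu> (Suc k)) l *
        (weight \<nu> (ts ! i) * (\<Prod>i'\<in>{..<?m} - {i}. weight \<nu> (ts ! i'))) * ?C)"
      by (simp add: pC)
    also have "weight \<nu> (ts ! i) * (\<Prod>i'\<in>{..<?m} - {i}. weight \<nu> (ts ! i')) = (\<Prod>i'<?m. weight \<nu> (ts ! i'))"
      using i by (subst prod.remove[of "{..<?m}" i]) auto
    also have "pmf (spine_order \<nu> (Suc k)) l * (\<Prod>i'<?m. weight \<nu> (ts ! i')) * ?C
        = real ?m / fact ?m * weight \<nu> \<tau> * ?C"
      using pmf_spine_order[OF mean l, of "Suc k"] by (simp add: \<tau> weight_Node_nth)
    finally show ?thesis
      unfolding Ei by (auto intro: sets.Int sets_spine_event sets_cyl fin)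
  qed
  have finR: "finite ?R" by (intro finite_SigmaI) auto
  have "spine_event (Suc k) \<tau> \<inter> cyl J a X b = (\<Union>r\<in>?R. E r)"
    unfolding \<tau> spine_event_Suc E_def case_prod_unfold by blast
  also have "prob \<dots> = (\<Sum>r\<in>?R. prob (E r))"
  proof (rule finite_measure_finite_Union[OF finR])
    \<comment> \<open>The configuration determines the order \<open>l\<close>, and in a list without
      repetitions the position of the label \<open>0\<close> determines \<open>i\<close>.\<close>
    have inj: "r = r'" if rr': "r \<in> ?R" "r' \<in> ?R" "snd r = snd r'" for r r'
    proof -
      obtain i l i' where r: "r = (i, l)" "r' = (i', l)"
        using rr'(3) by (cases r, cases r') simp
      then have l: "l \<in> ?P" "i < ?m" "i' < ?m" "l ! i = l ! i'" using rr' by simp_all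
      moreover have "distinct l" "length l = ?m"
        using l(1) length_finite_permutations_of_set[OF l(1)] by (simp_all add: permutations_of_set_def)
      ultimately show ?thesis using r nth_eq_iff_index_eq[of l i i'] by simp
    qed
    have snd: "snd r = fst \<xi> (Suc k)" if "\<xi> \<in> E r" for \<xi> r
      using that by (simp add: E_def case_prod_unfold)
    show "disjoint_family_on E ?R"
      unfolding disjoint_family_on_def
    proof (intro ballI impI)
      fix r r' assume "r \<in> ?R" "r' \<in> ?R" "r \<noteq> r'"
      then have "snd r \<noteq> snd r'" using inj by blast
      then show "E r \<inter> E r' = {}" using snd[of _ r] snd[of _ r'] by fastforce
    qed
    show "E ` ?R \<subseteq> events"
    proof (rule image_subsetI)
      fix r assume "r \<in> ?R"
      then show "E r \<in> events" using E[of "fst r" "snd r"] by (cases r) simp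
    qed
  qed
  also have "\<dots> = (\<Sum>i<?m. \<Sum>l\<in>{l \<in> ?P. l ! i = 0}. prob (E (i, l)))"
    by (subst sum.Sigma) auto
  also have "\<dots> = (\<Sum>i<?m. level_card k (ts ! i) * (weight \<nu> \<tau> * ?C))"
  proof (rule sum.cong[OF refl])
    fix i assume i: "i \<in> {..<?m}"
    \<comment> \<open>This is the cancellation along the spine: size biasing and the uniform order
      give \<open>?m / fact ?m\<close>, while \<open>fact (?m - 1)\<close> orders have the label
      \<open>0\<close> at position \<open>i\<close>.\<close>
    then have "(fact ?m :: real) = real ?m * fact (?m - 1)" and "ts \<noteq> []" by (cases ?m; auto)+
    then have "real ?m / fact ?m = 1 / fact (?m - 1)" by simp
    then have "prob (E (i, l)) = level_card k (ts ! i) * (weight \<nu> \<tau> * ?C) / fact (?m - 1)"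
      if "l \<in> {l \<in> ?P. l ! i = 0}" for l
      using E[of i l] that i by simp
    then show "(\<Sum>l\<in>{l \<in> ?P. l ! i = 0}. prob (E (i, l))) = level_card k (ts ! i) * (weight \<nu> \<tau> * ?C)"
      using i card_permutations_of_set_nth[of i ?m] by simp
  qed
  also have "\<dots> = level_card (Suc k) \<tau> * weight \<nu> \<tau> * ?C"
    by (simp add: \<tau> level_card_Suc_Node sum_distrib_right mult.assoc)
  finally show ?case .
qed

text \<open>Up to a null set the event is \<open>spine_event k \<tau>\<close>; the preceding result
  is applied with the cylinder that imposes no condition.\<close>

lemma measure_H_sin_tree:
  assumes mean: "measure_pmf.expectation \<nu> real = 1"
  shows "measure (sin_space \<nu>) {\<xi>. H k (sin_tree \<xi>) (0, []) = Some (words \<tau>)}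
    = level_card k \<tau> * weight \<nu> \<tau>"
proof -
  interpret prob_space "sin_space \<nu>" by (rule prob_space_sin_space)
  have eq: "{\<xi>. H k (sin_tree \<xi>) (0, []) = Some (words \<tau>)}
      = {\<xi>. Top (sin_tree \<xi>) (k, []) = words \<tau>} \<inter>
        {\<xi> \<in> space (sin_space \<nu>). \<forall>j\<in>{1..k}. 0 \<in> set (fst \<xi> j)}"
    by (rule set_eqI) (simp add: H_def ancestor_sin_tree space_sin_space)
  have meas: "{\<xi>. H k (sin_tree \<xi>) (0, []) = Some (words \<tau>)} \<in> events"
    unfolding eq using sets_sin_space_fst[of "\<lambda>l. 0 \<in> set l"]
    by (intro sets.Int sets_Top_sin_tree sets.sets_Collect_finite_All) (auto simp: space_sin_space)
  have "AE \<xi> in sin_space \<nu>. \<xi> \<in> {\<xi>. H k (sin_tree \<xi>) (0, []) = Some (words \<tau>)}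
      \<longleftrightarrow> \<xi> \<in> spine_event k \<tau> \<inter> cyl {} undefined {} undefined"
    using AE_spine_ok[OF mean]
  proof eventually_elim
    case (elim \<xi>)
    then have "0 \<in> set (fst \<xi> j)" if "0 < j" for j
      using that by (auto simp: spine_ok_def permutations_of_set_def)
    then have "\<forall>j\<in>{1..k}. 0 \<in> set (fst \<xi> j)" by simp
    with elim show ?case
      unfolding eq by (simp add: spine_event_def cyl_def space_sin_space)
  qed
  then have "prob {\<xi>. H k (sin_tree \<xi>) (0, []) = Some (words \<tau>)}
      = prob (spine_event k \<tau> \<inter> cyl {} undefined {} undefined)"
    using meas by (intro finite_measure_eq_AE) (auto intro: sets_spine_event sets_cyl)
  also have "\<dots> = level_card k \<tau> * weight \<nu> \<tau> * prob (cyl {} undefined {} undefined)"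
    by (rule measure_spine_event_cyl[OF mean]) auto
  also have "prob (cyl {} undefined {} undefined) = 1"
    by (simp add: measure_cyl)
  finally show ?thesis by simp
qed

section \<open>Concentration\<close>

lemma space_GW_space: "space (GW_space \<nu>) = UNIV"
  by (simp add: GW_space_def space_PiM_pmf)

text \<open>Only finitely many trees have size \<open>n\<close>, so the event is a finite disjoint
  union of cylinder events; \<open>Q\<close> expresses \<open>P\<close> through the
  datatype.\<close>

lemma measure_GW_space_has_size:
  assumes "\<And>\<omega> \<tau>. verts (GW_tree \<omega>) = words \<tau> \<Longrightarrow> P \<omega> \<longleftrightarrow> Q \<tau>"
  shows "measure (GW_space \<nu>) {\<omega>. P \<omega> \<and> has_size (GW_tree \<omega>) n}
    = (\<Sum>\<tau> | tsize \<tau> = n \<and> Q \<tau>. weight \<nu> \<tau>)"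
proof -
  interpret prob_space "GW_space \<nu>"
    unfolding GW_space_def by (rule prob_space_PiM_pmf)
  let ?E = "\<lambda>\<tau>. {\<omega>. verts (GW_tree \<omega>) = words \<tau>}"
  have "{\<omega>. P \<omega> \<and> has_size (GW_tree \<omega>) n} = (\<Union>\<tau>\<in>{\<tau>. tsize \<tau> = n \<and> Q \<tau>}. ?E \<tau>)"
  proof (intro equalityI subsetI)
    fix \<omega> assume *: "\<omega> \<in> {\<omega>. P \<omega> \<and> has_size (GW_tree \<omega>) n}"
    then obtain \<tau> where "verts (GW_tree \<omega>) = words \<tau>"
      using finite_verts_GW_tree by (auto simp: has_size_def)
    with * assms show "\<omega> \<in> (\<Union>\<tau>\<in>{\<tau>. tsize \<tau> = n \<and> Q \<tau>}. ?E \<tau>)"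
      by (auto simp: has_size_def)
  qed (use assms in \<open>auto simp: has_size_def\<close>)
  also have "prob \<dots> = (\<Sum>\<tau> | tsize \<tau> = n \<and> Q \<tau>. prob (?E \<tau>))"
  proof (rule finite_measure_finite_Union)
    show "disjoint_family_on ?E {\<tau>. tsize \<tau> = n \<and> Q \<tau>}"
      by (auto simp: disjoint_family_on_def words_inject)
  qed (auto intro: sets_verts_GW_tree finite_subset[OF _ finite_tsize_eq[of n]])
  finally show ?thesis by (simp add: measure_verts_GW_tree)
qed

theorem proposition7:
  fixes \<nu> :: "nat pmf" and k :: nat and t :: word_tree and \<epsilon> :: real
  assumes mean: "measure_pmf.expectation \<nu> real = 1"
    and finite_variance:
      "integrable (measure_pmf \<nu>) (\<lambda>i. (real i - measure_pmf.expectation \<nu> real)\<^sup>2)"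
    and nontrivial: "\<nu> \<noteq> return_pmf 1"
    and tree: "finite_word_tree t"
    and height: "k \<le> height t"
    and eps: "0 < \<epsilon>"
  shows "\<exists>\<delta>>0. \<exists>n0::nat. \<forall>n\<ge>n0.
    \<P>(\<omega> in GW_space \<nu>. has_size (GW_tree \<omega>) n) > 0 \<longrightarrow>
    \<P>(\<omega> in GW_space \<nu>.
        \<bar>1 / real n * (\<Sum>x\<in>verts (GW_tree \<omega>). of_bool (H k (GW_tree \<omega>) x = Some t))
          - \<P>(\<xi> in sin_space \<nu>. H k (sin_tree \<xi>) (0, []) = Some t)\<bar> \<ge> \<epsilon>
      \<bar> has_size (GW_tree \<omega>) n)
    \<le> exp (- \<delta> * real n)"
proof -
  have var: "integrable (measure_pmf \<nu>) (\<lambda>i. (real i - 1)\<^sup>2)"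
    using finite_variance by (simp add: mean)
  obtain \<sigma> where \<sigma>: "t = words \<sigma>" using finite_word_tree_words[OF tree] by auto
  define p Z where "p = weight \<nu> \<sigma>" and "Z = real (level_card k \<sigma>)"
  have sin: "\<P>(\<xi> in sin_space \<nu>. H k (sin_tree \<xi>) (0, []) = Some t) = Z * p"
    by (simp add: \<sigma> space_sin_space measure_H_sin_tree[OF mean] p_def Z_def)
  have \<nu>0: "pmf \<nu> 0 < 1"
  proof -
    obtain b where b: "b \<in> set_pmf \<nu>" "2 \<le> b"
      using two_le_in_support[OF mean var nontrivial] by blast
    then have "0 < pmf \<nu> b" by (simp add: pmf_positive)
    then show ?thesis using sum_pmf_le_1[of "{0, b}" \<nu>] b by simp
  qed
  \<comment> \<open>By \<open>\<bar>Z * x\<bar> \<le> (Z + 1) * \<bar>x\<bar>\<close>, a deviation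
    \<open>\<epsilon>\<close> of the frequency forces a deviation \<open>\<epsilon>'\<close> of
    \<open>occ \<sigma> \<tau> / n\<close> from \<open>p\<close>.\<close>
  define \<epsilon>' where "\<epsilon>' = \<epsilon> / (Z + 1)"
  have Z: "0 \<le> Z" by (simp add: Z_def)
  have \<epsilon>': "0 < \<epsilon>'" using eps Z by (simp add: \<epsilon>'_def)
  obtain \<delta>1 where \<delta>1: "0 < \<delta>1"
      "\<And>n. (\<Sum>\<tau> | tsize \<tau> = n \<and> (p + \<epsilon>') * n \<le> occ \<sigma> \<tau>. weight \<nu> \<tau>) \<le> exp (- \<delta>1 * real n)"
    using occ_upper_tail[OF \<epsilon>', of \<nu> \<sigma>] unfolding p_def by blast
  obtain \<delta>2 where \<delta>2: "0 < \<delta>2"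
      "\<And>n. (\<Sum>\<tau> | tsize \<tau> = n \<and> occ \<sigma> \<tau> \<le> (p - \<epsilon>') * n. weight \<nu> \<tau>) \<le> exp (- \<delta>2 * real n)"
    using occ_lower_tail[OF \<nu>0 \<epsilon>', of \<sigma>] unfolding p_def by blast
  define \<delta> where "\<delta> = min \<delta>1 \<delta>2"
  have \<delta>: "0 < \<delta>" "\<delta> \<le> \<delta>1" "\<delta> \<le> \<delta>2" using \<delta>1 \<delta>2 by (auto simp: \<delta>_def)
  define q where "q n = (\<Sum>\<tau> | tsize \<tau> = n. weight \<nu> \<tau>)" for n
  define bad where "bad n \<tau> \<longleftrightarrow> \<epsilon> \<le> \<bar>1 / real n * (Z * occ \<sigma> \<tau>) - Z * p\<bar>" for n \<tau>
  have size: "\<P>(\<omega> in GW_space \<nu>. has_size (GW_tree \<omega>) n) = q n" for n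
    using measure_GW_space_has_size[of "\<lambda>_. True" "\<lambda>_. True" \<nu> n] by (simp add: space_GW_space q_def)
  have bad: "\<P>(\<omega> in GW_space \<nu>.
        \<bar>1 / real n * (\<Sum>x\<in>verts (GW_tree \<omega>). of_bool (H k (GW_tree \<omega>) x = Some t))
          - \<P>(\<xi> in sin_space \<nu>. H k (sin_tree \<xi>) (0, []) = Some t)\<bar> \<ge> \<epsilon>
      \<bar> has_size (GW_tree \<omega>) n) = (\<Sum>\<tau> | tsize \<tau> = n \<and> bad n \<tau>. weight \<nu> \<tau>) / q n" for n
  proof -
    have "measure (GW_space \<nu>) {\<omega>. \<epsilon> \<le> \<bar>1 / real n *
        (\<Sum>x\<in>verts (GW_tree \<omega>). of_bool (H k (GW_tree \<omega>) x = Some t)) - Z * p\<bar> \<and> has_size (GW_tree \<omega>) n}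
        = (\<Sum>\<tau> | tsize \<tau> = n \<and> bad n \<tau>. weight \<nu> \<tau>)"
    proof (rule measure_GW_space_has_size)
      fix \<omega> \<tau> assume "verts (GW_tree \<omega>) = words \<tau>"
      from sum_H_GW_tree[OF this, of k \<sigma>]
      show "\<epsilon> \<le> \<bar>1 / real n * (\<Sum>x\<in>verts (GW_tree \<omega>). of_bool (H k (GW_tree \<omega>) x = Some t)) - Z * p\<bar>
          \<longleftrightarrow> bad n \<tau>"
        unfolding \<sigma> bad_def Z_def by (simp only: of_nat_mult)
    qed
    then show ?thesis unfolding sin using size[of n] by (simp add: cond_prob_def space_GW_space)
  qed
  \<comment> \<open>Of the rate \<open>\<delta>\<close> one quarter pays for dividing by
    \<open>q n\<close> and one quarter for the factor \<open>2\<close> from the two tails;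
    \<open>\<delta> / 2\<close> remains.\<close>
  have "\<forall>\<^sub>F n in sequentially. 0 < q n \<longrightarrow> exp (- (\<delta> / 4) * n) \<le> q n"
    unfolding q_def using \<delta> by (intro sum_weight_subexponential[OF mean var nontrivial]) simp
  moreover have "\<forall>\<^sub>F n::nat in sequentially. 2 \<le> exp (\<delta> / 4 * n)"
    using \<delta> by real_asymp
  ultimately have "\<forall>\<^sub>F n in sequentially. 0 < q n \<longrightarrow>
      (\<Sum>\<tau> | tsize \<tau> = n \<and> bad n \<tau>. weight \<nu> \<tau>) / q n \<le> exp (- (\<delta> / 2) * n)"
    using eventually_gt_at_top[of 0]
  proof eventually_elim
    case (elim n)
    let ?U = "{\<tau>. tsize \<tau> = n \<and> (p + \<epsilon>') * n \<le> occ \<sigma> \<tau>}"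
      and ?L = "{\<tau>. tsize \<tau> = n \<and> occ \<sigma> \<tau> \<le> (p - \<epsilon>') * n}"
    have fin: "finite ?U" "finite ?L"
      by (auto intro: finite_subset[OF _ finite_tsize_eq[of n]])
    have "{\<tau>. tsize \<tau> = n \<and> bad n \<tau>} \<subseteq> ?U \<union> ?L"
    proof
      fix \<tau> assume \<tau>: "\<tau> \<in> {\<tau>. tsize \<tau> = n \<and> bad n \<tau>}"
      let ?x = "occ \<sigma> \<tau> / n - p"
      have "\<epsilon> \<le> \<bar>Z * ?x\<bar>" using \<tau> by (simp add: bad_def algebra_simps)
      also have "\<dots> \<le> (Z + 1) * \<bar>?x\<bar>" using Z by (simp add: abs_mult distrib_right)
      finally have "\<epsilon>' \<le> \<bar>?x\<bar>" using Z by (simp add: \<epsilon>'_def field_simps)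
      then have "p + \<epsilon>' \<le> occ \<sigma> \<tau> / n \<or> occ \<sigma> \<tau> / n \<le> p - \<epsilon>'" by linarith
      then show "\<tau> \<in> ?U \<union> ?L" using elim(3) \<tau> by (auto simp: field_simps)
    qed
    then have "(\<Sum>\<tau> | tsize \<tau> = n \<and> bad n \<tau>. weight \<nu> \<tau>) \<le> (\<Sum>\<tau>\<in>?U \<union> ?L. weight \<nu> \<tau>)"
      using fin by (intro sum_mono2) auto
    also have "\<dots> \<le> (\<Sum>\<tau>\<in>?U. weight \<nu> \<tau>) + (\<Sum>\<tau>\<in>?L. weight \<nu> \<tau>)"
      using fin by (simp add: sum_Un sum_nonneg)
    also have "\<dots> \<le> exp (- \<delta>1 * n) + exp (- \<delta>2 * n)"
      by (intro add_mono \<delta>1 \<delta>2)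
    also have "\<dots> \<le> exp (- \<delta> * n) + exp (- \<delta> * n)"
      using \<delta> by (intro add_mono) (auto intro: mult_right_mono)
    also have "\<dots> \<le> exp (\<delta> / 4 * n) * exp (- \<delta> * n)"
      using elim(2) mult_right_mono[of 2 "exp (\<delta> / 4 * n)" "exp (- \<delta> * n)"] by simp
    also have "\<dots> = exp (- (\<delta> / 2) * n) * exp (- (\<delta> / 4) * n)"
      by (simp flip: exp_add add: field_simps)
    finally have le: "(\<Sum>\<tau> | tsize \<tau> = n \<and> bad n \<tau>. weight \<nu> \<tau>)
        \<le> exp (- (\<delta> / 2) * n) * exp (- (\<delta> / 4) * n)" .
    show ?case
    proof
      assume q: "0 < q n"
      then have "exp (- (\<delta> / 2) * n) * exp (- (\<delta> / 4) * n) \<le> exp (- (\<delta> / 2) * n) * q n"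
        using elim(1) by (intro mult_left_mono) auto
      with le have "(\<Sum>\<tau> | tsize \<tau> = n \<and> bad n \<tau>. weight \<nu> \<tau>) \<le> exp (- (\<delta> / 2) * n) * q n"
        by (rule order_trans)
      with q show "(\<Sum>\<tau> | tsize \<tau> = n \<and> bad n \<tau>. weight \<nu> \<tau>) / q n \<le> exp (- (\<delta> / 2) * n)"
        by (simp add: divide_le_eq)
    qed
  qed
  then obtain n0 where "\<forall>n\<ge>n0. 0 < q n \<longrightarrow>
      (\<Sum>\<tau> | tsize \<tau> = n \<and> bad n \<tau>. weight \<nu> \<tau>) / q n \<le> exp (- (\<delta> / 2) * n)"
    by (auto simp: eventually_sequentially)
  then show ?thesis
    unfolding size bad using \<delta> by (intro exI[of _ "\<delta> / 2"] conjI exI[of _ n0]) auto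
qed

end
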